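(* Let $\rho\ge0$. Assume that $\ell(\cdot,b):\mathbb{R}^s\to\mathbb{R}$ is $L_\ell$-smooth and convex and that each $r_i:\mathbb{R}^{d_i}\to\mathbb{R}$ ($i=1,\dots,n$) is $L_r$-smooth and convex. Let the sequence be generated by the algorithm for the augmented problem described in the context, from any starting point $(x^0,z^0,y^0)\in\mathbb{R}^{d+2s}$, with stepsize $$\gamma=\frac14\min\left\{1;\ \frac1\rho;\ \frac1{\sqrt{\lambda_{\max}(A^TA)}};\ \frac1{\sqrt{\rho\lambda_{\max}(A^TA)}};\ \frac1{\rho\lambda_{\max}(A^TA)};\ \frac1{L_r};\ \frac1{L_\ell}\right\}.$$ Then there is an absolute constant $C>0$ such that for every $K\ge1$ $$\mathrm{gap}_{\mathrm{aug}}(\bar x^K,\bar z^K,\bar y^K)\le C\,\frac{\left(1+\rho+\sqrt{(1+\rho)\lambda_{\max}(A^TA)}+\rho\lambda_{\max}(A^TA)+L_\ell+L_r\right)D^2}{K},$$ where $\bar x^K=\frac1K\sum_{k=0}^{K-1}x^{k+1/2}$, $\bar z^K=\frac1K\sum_{k=0}^{K-1}z^{k+1/2}$, $\bar y^K=\frac1K\sum_{k=0}^{K-1}y^{k+1/2}$ and $D^2=\max_{x\in\mathcal X,z\in\mathcal Z,y\in\mathcal Y}\left[\|x^0-x\|^2+\|z^0-z\|^2+\|y^0-y\|^2\right]$.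
   Context: Setting: $n,s,d_1,\dots,d_n$ are positive integers, $d=\sum_i d_i$, $A_i\in\mathbb{R}^{s\times d_i}$, $A=[A_1,\dots,A_n]\in\mathbb{R}^{s\times d}$, $b\in\mathbb{R}^s$ is fixed, and $x=(x_1,\dots,x_n)\in\mathbb{R}^d$ with $x_i\in\mathbb{R}^{d_i}$, so $Ax=\sum_iA_ix_i$. $\ell:\mathbb{R}^s\times\mathbb{R}^s\to\mathbb{R}$, and $\nabla\ell(z,b)$ is the gradient in the first argument. The saddle point problem is $\min_{(x,z)\in\mathbb{R}^{d+s}}\max_{y\in\mathbb{R}^s}L_{\mathrm{aug}}(x,z,y)$ with $$L_{\mathrm{aug}}(x,z,y)=\ell(z,b)+\sum_{i=1}^nr_i(x_i)+y^T\Big(\sum_{i=1}^nA_ix_i-z\Big)+\frac\rho2\Big\|\sum_{i=1}^nA_ix_i-z\Big\|^2.$$ $\mathcal X\subset\mathbb{R}^d$, $\mathcal Z\subset\mathbb{R}^s$, $\mathcal Y\subset\mathbb{R}^s$ are nonempty compact sets used only to define the criterion $$\mathrm{gap}_{\mathrm{aug}}(x,z,y)=\max_{\tilde y\in\mathcal Y}L_{\mathrm{aug}}(x,z,\tilde y)-\min_{\tilde x\in\mathcal X,\tilde z\in\mathcal Z}L_{\mathrm{aug}}(\tilde x,\tilde z,y).$$ A function $f$ is $L$-smooth ($L>0$) if it is differentiable and $\|\nabla f(u)-\nabla f(v)\|\le L\|u-v\|$ for all $u,v$. Norms are Euclidean; $\lambda_{\max}$ is the largest eigenvalue; $1/0=+\infty$.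 Algorithm: for $k=0,\dots,K-1$, $x_i^{k+1/2}=x_i^k-\gamma\big(A_i^Ty^k+\nabla r_i(x_i^k)+\rho A_i^T(Ax^k-z^k)\big)$ for all $i$; $z^{k+1/2}=z^k-\gamma\big(\nabla\ell(z^k,b)-y^k+\rho(z^k-Ax^k)\big)$; $y^{k+1/2}=y^k+\gamma(Ax^k-z^k)$; $x_i^{k+1}=x_i^k-\gamma\big(A_i^Ty^{k+1/2}+\nabla r_i(x_i^{k+1/2})+\rho A_i^T(Ax^{k+1/2}-z^{k+1/2})\big)$ for all $i$; $z^{k+1}=z^k-\gamma\big(\nabla\ell(z^{k+1/2},b)-y^{k+1/2}+\rho(z^{k+1/2}-Ax^{k+1/2})\big)$; $y^{k+1}=y^k+\gamma(Ax^{k+1/2}-z^{k+1/2})$. *)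

theory Defs
  imports
    "Jordan_Normal_Form.Spectral_Radius"
    "HOL-Library.Extended_Real"
    "HOL-Analysis.L2_Norm"
    "HOL-Analysis.Abstract_Metric_Spaces"
begin

hide_type (open) Finite_Cartesian_Product.vec
hide_const (open) Finite_Cartesian_Product.vec
unbundle no vec_syntax

text \<open>
  The Euclidean space of dimension \<open>m\<close> is \<open>carrier_vec m :: real vec set\<close>: the claimed constant
  must not depend on any of the dimensions, so these are quantified inside the formula and
  cannot be types.
\<close>

definition vnorm :: "real vec \<Rightarrow> real" where
  "vnorm v = L2_set (\<lambda>i. v $ i) {..<dim_vec v}"

text \<open>
  The distance carries the dimension as a parameter because \<open>vnorm (x - y)\<close> is not symmetric
  when the dimensions of \<open>x\<close> and \<open>y\<close> differ, while \<open>Metric_space\<close> asks for symmetry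
  on the whole type.
\<close>

definition vdist :: "nat \<Rightarrow> real vec \<Rightarrow> real vec \<Rightarrow> real" where
  "vdist m x y = L2_set (\<lambda>i. x $ i - y $ i) {..<m}"

lemma vdist_eq_vnorm:
  "x \<in> carrier_vec m \<Longrightarrow> y \<in> carrier_vec m \<Longrightarrow> vdist m x y = vnorm (x - y)"
  unfolding vdist_def vnorm_def by (auto intro!: L2_set_cong)

lemma vnorm_power2: "(vnorm v)\<^sup>2 = v \<bullet> v"
  by (simp add: vnorm_def L2_set_def sum_nonneg scalar_prod_def power2_eq_square
      lessThan_atLeast0)

lemma Metric_space_vdist: "Metric_space (carrier_vec m) (vdist m)"
proof
  fix x y z :: "real vec"
  show "0 \<le> vdist m x y" by (simp add: vdist_def)
  show "vdist m x y = vdist m y x"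
    by (simp add: vdist_def L2_set_def power2_commute)
  show "vdist m x y = 0 \<longleftrightarrow> x = y" if "x \<in> carrier_vec m" "y \<in> carrier_vec m"
    using that by (auto simp: vdist_def L2_set_eq_0_iff)
  show "vdist m x z \<le> vdist m x y + vdist m y z"
    using L2_set_triangle_ineq[of "\<lambda>i. x $ i - y $ i" "\<lambda>i. y $ i - z $ i" "{..<m}"]
    by (simp add: vdist_def)
qed

definition vcompact :: "nat \<Rightarrow> real vec set \<Rightarrow> bool" where
  "vcompact m S \<longleftrightarrow> compactin (Metric_space.mtopology (carrier_vec m) (vdist m)) S"

definition vconvex :: "nat \<Rightarrow> (real vec \<Rightarrow> real) \<Rightarrow> bool" where
  "vconvex m f \<longleftrightarrow>
     (\<forall>u\<in>carrier_vec m. \<forall>v\<in>carrier_vec m. \<forall>t\<in>{0..1}.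
        f (t \<cdot>\<^sub>v u + (1 - t) \<cdot>\<^sub>v v) \<le> t * f u + (1 - t) * f v)"

definition has_vgrad :: "nat \<Rightarrow> (real vec \<Rightarrow> real) \<Rightarrow> real vec \<Rightarrow> real vec \<Rightarrow> bool" where
  "has_vgrad m f x g \<longleftrightarrow>
     g \<in> carrier_vec m \<and>
     (\<forall>\<epsilon>>0. \<exists>\<delta>>0. \<forall>h\<in>carrier_vec m. vnorm h < \<delta> \<longrightarrow>
        \<bar>f (x + h) - f x - g \<bullet> h\<bar> \<le> \<epsilon> * vnorm h)"

definition vgrad :: "nat \<Rightarrow> (real vec \<Rightarrow> real) \<Rightarrow> real vec \<Rightarrow> real vec" where
  "vgrad m f x = (THE g. has_vgrad m f x g)"

lemma has_vgrad_unique: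
  assumes g: "has_vgrad m f x g" and g': "has_vgrad m f x g'"
  shows "g = g'"
proof (rule ccontr)
  assume ne: "g \<noteq> g'"
  have c: "g \<in> carrier_vec m" "g' \<in> carrier_vec m"
    using g g' by (auto simp: has_vgrad_def)
  define w where "w = g - g'"
  have w: "w \<in> carrier_vec m" using c by (simp add: w_def)
  define N where "N = vnorm w"
  have "vdist m g g' \<noteq> 0"
    using ne c Metric_space.zero[OF Metric_space_vdist, of g m g'] by simp
  then have N: "N > 0"
    using c by (auto simp: vdist_eq_vnorm N_def w_def vnorm_def order_less_le)
  obtain \<delta> where \<delta>: "\<delta> > 0"
    "\<And>h. h \<in> carrier_vec m \<Longrightarrow> vnorm h < \<delta> \<Longrightarrow> \<bar>f (x + h) - f x - g \<bullet> h\<bar> \<le> N / 4 * vnorm h"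
    using g N unfolding has_vgrad_def by (metis zero_less_divide_iff zero_less_numeral)
  obtain \<delta>' where \<delta>': "\<delta>' > 0"
    "\<And>h. h \<in> carrier_vec m \<Longrightarrow> vnorm h < \<delta>' \<Longrightarrow> \<bar>f (x + h) - f x - g' \<bullet> h\<bar> \<le> N / 4 * vnorm h"
    using g' N unfolding has_vgrad_def by (metis zero_less_divide_iff zero_less_numeral)
  define t where "t = min \<delta> \<delta>' / (2 * N)"
  have t: "t > 0" using \<delta>(1) \<delta>'(1) N by (simp add: t_def)
  define h where "h = t \<cdot>\<^sub>v w"
  have h: "h \<in> carrier_vec m" using w by (simp add: h_def)
  have "vnorm h = L2_set (\<lambda>i. t * w $ i) {..<dim_vec w}"
    unfolding vnorm_def h_def by (auto intro!: L2_set_cong)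
  also have "\<dots> = t * N"
    using t by (simp add: N_def vnorm_def L2_set_right_distrib)
  finally have nh: "vnorm h = t * N" .
  have "t * N = min \<delta> \<delta>' / 2" using N by (simp add: t_def)
  then have "vnorm h < \<delta>" "vnorm h < \<delta>'" using nh \<delta>(1) \<delta>'(1) by auto
  then have "\<bar>g \<bullet> h - g' \<bullet> h\<bar> \<le> N / 4 * vnorm h + N / 4 * vnorm h"
    using \<delta>(2)[OF h] \<delta>'(2)[OF h] by linarith
  then have le: "\<bar>g \<bullet> h - g' \<bullet> h\<bar> \<le> N / 2 * (t * N)"
    unfolding nh by (simp add: mult.commute)
  have "g \<bullet> h - g' \<bullet> h = w \<bullet> h"
    unfolding w_def by (rule minus_scalar_prod_distrib[symmetric]) (use c h in auto)
  also have "\<dots> = t * N\<^sup>2"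
    using w by (simp add: h_def N_def vnorm_power2)
  finally have "t * N\<^sup>2 \<le> N / 2 * (t * N)" using le by simp
  then show False using t N by (simp add: power2_eq_square)
qed

lemma vgrad_eqI: "has_vgrad m f x g \<Longrightarrow> vgrad m f x = g"
  unfolding vgrad_def by (blast intro: the_equality has_vgrad_unique)

definition vsmooth :: "nat \<Rightarrow> real \<Rightarrow> (real vec \<Rightarrow> real) \<Rightarrow> bool" where
  "vsmooth m L f \<longleftrightarrow>
     L > 0 \<and>
     (\<forall>u\<in>carrier_vec m. \<exists>g. has_vgrad m f u g) \<and>
     (\<forall>u\<in>carrier_vec m. \<forall>v\<in>carrier_vec m.
        vnorm (vgrad m f u - vgrad m f v) \<le> L * vnorm (u - v))"

definition vaverage :: "nat \<Rightarrow> nat \<Rightarrow> (nat \<Rightarrow> real vec) \<Rightarrow> real vec" where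
  "vaverage m K v = (1 / real K) \<cdot>\<^sub>v finsum_vec TYPE(real) m v {..<K}"

definition lambda_max :: "real mat \<Rightarrow> real" where
  "lambda_max M = Max (spectrum M)"

text \<open>The blocks are indexed by \<open>i < n\<close>.\<close>

definition total_dim :: "nat \<Rightarrow> (nat \<Rightarrow> nat) \<Rightarrow> nat" where
  "total_dim n d = (\<Sum>i<n. d i)"

definition block :: "(nat \<Rightarrow> nat) \<Rightarrow> real vec \<Rightarrow> nat \<Rightarrow> real vec" where
  "block d x i = vec (d i) (\<lambda>j. x $ (total_dim i d + j))"

fun hcat :: "nat \<Rightarrow> nat \<Rightarrow> (nat \<Rightarrow> real mat) \<Rightarrow> real mat" where
  "hcat s 0 A = 0\<^sub>m s 0"
| "hcat s (Suc n) A =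
     four_block_mat (hcat s n A) (A n) (0\<^sub>m 0 (dim_col (hcat s n A))) (0\<^sub>m 0 (dim_col (A n)))"

lemma hcat_carrier:
  "(\<And>i. i < n \<Longrightarrow> A i \<in> carrier_mat s (d i)) \<Longrightarrow> hcat s n A \<in> carrier_mat s (total_dim n d)"
proof (induction n)
  case (Suc n)
  have "hcat s n A \<in> carrier_mat s (total_dim n d)" "A n \<in> carrier_mat s (d n)"
    using Suc by auto
  then show ?case by (auto simp: total_dim_def)
qed (simp add: total_dim_def)

lemma hcat_mult_vec:
  assumes "\<And>i. i < n \<Longrightarrow> A i \<in> carrier_mat s (d i)"
    and "x \<in> carrier_vec (total_dim n d)"
  shows "hcat s n A *\<^sub>v x = finsum_vec TYPE(real) s (\<lambda>i. A i *\<^sub>v block d x i) {..<n}"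
proof (rule eq_vecI)
  have bc: "A i *\<^sub>v block d x i \<in> carrier_vec s" if "i < n" for i
    using mult_mat_vec_carrier[OF assms(1)[OF that]] by (simp add: block_def)
  have hc: "hcat s n A \<in> carrier_mat s (total_dim n d)"
    using assms(1) by (rule hcat_carrier)
  have fc: "finsum_vec TYPE(real) s (\<lambda>i. A i *\<^sub>v block d x i) {..<n} \<in> carrier_vec s"
    using bc by (intro finsum_vec_closed) auto
  show "dim_vec (hcat s n A *\<^sub>v x)
      = dim_vec (finsum_vec TYPE(real) s (\<lambda>i. A i *\<^sub>v block d x i) {..<n})"
    using hc fc by simp
  fix j assume "j < dim_vec (finsum_vec TYPE(real) s (\<lambda>i. A i *\<^sub>v block d x i) {..<n})"
  then have j: "j < s" using fc by simp
  have entries: "(\<Sum>c<total_dim n d. hcat s n A $$ (j, c) * x $ c)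
      = (\<Sum>i<n. \<Sum>c<d i. A i $$ (j, c) * x $ (total_dim i d + c))"
    using assms(1)
  proof (induction n)
    case (Suc n)
    let ?p = "total_dim n d"
    have H: "hcat s n A \<in> carrier_mat s ?p" "A n \<in> carrier_mat s (d n)"
      using Suc.prems hcat_carrier[of n A s d] by auto
    have split: "(\<Sum>c<p + q. f c) = (\<Sum>c<p. f c) + (\<Sum>c<q. f (p + c))"
      for p q and f :: "nat \<Rightarrow> real"
      by (induction q) (simp_all add: algebra_simps)
    have "(\<Sum>c<total_dim (Suc n) d. hcat s (Suc n) A $$ (j, c) * x $ c)
        = (\<Sum>c<?p. hcat s n A $$ (j, c) * x $ c) + (\<Sum>c<d n. A n $$ (j, c) * x $ (?p + c))"
      using H j by (simp add: total_dim_def split)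
    then show ?case using Suc by simp
  qed (simp add: total_dim_def)
  have "(hcat s n A *\<^sub>v x) $ j = (\<Sum>c<total_dim n d. hcat s n A $$ (j, c) * x $ c)"
    using hc assms(2) j
    by (auto simp: scalar_prod_def lessThan_atLeast0 intro!: sum.cong)
  also have "\<dots> = (\<Sum>i<n. (A i *\<^sub>v block d x i) $ j)"
    unfolding entries
  proof (intro sum.cong refl)
    fix i assume "i \<in> {..<n}"
    then have "dim_row (A i) = s" "dim_col (A i) = d i" using assms(1)[of i] by auto
    then show "(\<Sum>c<d i. A i $$ (j, c) * x $ (total_dim i d + c)) = (A i *\<^sub>v block d x i) $ j"
      using j by (simp add: scalar_prod_def block_def lessThan_atLeast0)
  qed
  also have "\<dots> = finsum_vec TYPE(real) s (\<lambda>i. A i *\<^sub>v block d x i) {..<n} $ j"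
    using bc j by (subst index_finsum_vec) auto
  finally show "(hcat s n A *\<^sub>v x) $ j
      = finsum_vec TYPE(real) s (\<lambda>i. A i *\<^sub>v block d x i) {..<n} $ j" .
qed

definition L_aug ::
  "nat \<Rightarrow> nat \<Rightarrow> (nat \<Rightarrow> nat) \<Rightarrow> (nat \<Rightarrow> real mat) \<Rightarrow> (real vec \<Rightarrow> real vec \<Rightarrow> real) \<Rightarrow>
   real vec \<Rightarrow> (nat \<Rightarrow> real vec \<Rightarrow> real) \<Rightarrow> real \<Rightarrow> real vec \<Rightarrow> real vec \<Rightarrow> real vec \<Rightarrow> real" where
  "L_aug n s d A ell b r \<rho> x z y =
     (let c = finsum_vec TYPE(real) s (\<lambda>i. A i *\<^sub>v block d x i) {..<n} - z
      in ell z b + (\<Sum>i<n. r i (block d x i)) + y \<bullet> c + \<rho> / 2 * (vnorm c)\<^sup>2)"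

text \<open>
  On reals, \<open>SUP\<close> and \<open>INF\<close> are the maximum and the minimum whenever these are attained; this is
  so below, for continuous functions on nonempty compact sets.
\<close>

definition gap_aug ::
  "nat \<Rightarrow> nat \<Rightarrow> (nat \<Rightarrow> nat) \<Rightarrow> (nat \<Rightarrow> real mat) \<Rightarrow> (real vec \<Rightarrow> real vec \<Rightarrow> real) \<Rightarrow>
   real vec \<Rightarrow> (nat \<Rightarrow> real vec \<Rightarrow> real) \<Rightarrow> real \<Rightarrow>
   real vec set \<Rightarrow> real vec set \<Rightarrow> real vec set \<Rightarrow> real vec \<Rightarrow> real vec \<Rightarrow> real vec \<Rightarrow> real" where
  "gap_aug n s d A ell b r \<rho> X Z Y x z y =
     (SUP y'\<in>Y. L_aug n s d A ell b r \<rho> x z y')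
     - (INF (x', z')\<in>X \<times> Z. L_aug n s d A ell b r \<rho> x' z' y)"

definition max_sq_dist ::
  "real vec set \<Rightarrow> real vec set \<Rightarrow> real vec set \<Rightarrow> real vec \<Rightarrow> real vec \<Rightarrow> real vec \<Rightarrow> real" where
  "max_sq_dist X Z Y x0 z0 y0 =
     (SUP (x, z, y)\<in>X \<times> Z \<times> Y. (vnorm (x0 - x))\<^sup>2 + (vnorm (z0 - z))\<^sup>2 + (vnorm (y0 - y))\<^sup>2)"

text \<open>Taken in \<open>ereal\<close>, where \<open>1 / 0 = \<infinity>\<close>; the minimum is finite because of the entry \<open>1\<close>.\<close>

definition stepsize :: "real \<Rightarrow> real \<Rightarrow> real \<Rightarrow> real \<Rightarrow> real" where
  "stepsize \<rho> lam L\<^sub>r L\<^sub>l =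
     1 / 4 * real_of_ereal (Min {1, 1 / ereal \<rho>, 1 / ereal (sqrt lam), 1 / ereal (sqrt (\<rho> * lam)),
       1 / ereal (\<rho> * lam), 1 / ereal L\<^sub>r, 1 / ereal L\<^sub>l})"

lemma stepsize_entry_at_0: "1 / ereal 0 = \<infinity>"
  by simp

text \<open>\<open>xh k\<close>, \<open>zh k\<close>, \<open>yh k\<close> are the iterates with index \<open>k + 1/2\<close>.\<close>

definition extragradient_run ::
  "nat \<Rightarrow> nat \<Rightarrow> (nat \<Rightarrow> nat) \<Rightarrow> (nat \<Rightarrow> real mat) \<Rightarrow> (real vec \<Rightarrow> real vec \<Rightarrow> real) \<Rightarrow>
   real vec \<Rightarrow> (nat \<Rightarrow> real vec \<Rightarrow> real) \<Rightarrow> real \<Rightarrow> real \<Rightarrow> nat \<Rightarrow>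
   (nat \<Rightarrow> real vec) \<Rightarrow> (nat \<Rightarrow> real vec) \<Rightarrow> (nat \<Rightarrow> real vec) \<Rightarrow>
   (nat \<Rightarrow> real vec) \<Rightarrow> (nat \<Rightarrow> real vec) \<Rightarrow> (nat \<Rightarrow> real vec) \<Rightarrow> bool" where
  "extragradient_run n s d A ell b r \<rho> \<gamma> K x z y xh zh yh \<longleftrightarrow>
     (\<forall>k\<le>K. x k \<in> carrier_vec (total_dim n d) \<and> z k \<in> carrier_vec s \<and> y k \<in> carrier_vec s) \<and>
     (\<forall>k<K. xh k \<in> carrier_vec (total_dim n d) \<and> zh k \<in> carrier_vec s \<and> yh k \<in> carrier_vec s) \<and>
     (\<forall>k<K.
        (\<forall>i<n. block d (xh k) i = block d (x k) i - \<gamma> \<cdot>\<^sub>v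
           ((A i)\<^sup>T *\<^sub>v y k + vgrad (d i) (r i) (block d (x k) i)
            + \<rho> \<cdot>\<^sub>v ((A i)\<^sup>T *\<^sub>v (hcat s n A *\<^sub>v x k - z k)))) \<and>
        zh k = z k - \<gamma> \<cdot>\<^sub>v
           (vgrad s (\<lambda>u. ell u b) (z k) - y k + \<rho> \<cdot>\<^sub>v (z k - hcat s n A *\<^sub>v x k)) \<and>
        yh k = y k + \<gamma> \<cdot>\<^sub>v (hcat s n A *\<^sub>v x k - z k) \<and>
        (\<forall>i<n. block d (x (Suc k)) i = block d (x k) i - \<gamma> \<cdot>\<^sub>v
           ((A i)\<^sup>T *\<^sub>v yh k + vgrad (d i) (r i) (block d (xh k) i)
            + \<rho> \<cdot>\<^sub>v ((A i)\<^sup>T *\<^sub>v (hcat s n A *\<^sub>v xh k - zh k)))) \<and>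
        z (Suc k) = z k - \<gamma> \<cdot>\<^sub>v
           (vgrad s (\<lambda>u. ell u b) (zh k) - yh k + \<rho> \<cdot>\<^sub>v (zh k - hcat s n A *\<^sub>v xh k)) \<and>
        y (Suc k) = y k + \<gamma> \<cdot>\<^sub>v (hcat s n A *\<^sub>v xh k - zh k))"

end

theory Submission
  imports Defs
begin

text \<open>
  Put \<open>u = (x, z, y)\<close> and \<open>F = (\<nabla>\<^sub>x L, \<nabla>\<^sub>z L, - \<nabla>\<^sub>y L)\<close> for the augmented Lagrangian \<open>L\<close>.
  The algorithm is the extragradient method for \<open>F\<close>, so for every \<open>w\<close>
  \<open>2 \<gamma> (F u\<^sub>h) \<bullet> (u\<^sub>h - w) \<le> \<bar>u - w\<bar>\<^sup>2 - \<bar>u\<^sub>+ - w\<bar>\<^sup>2\<close> whenever \<open>\<gamma> F\<close> is nonexpansive. Each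
  block of \<open>F\<close> has at most four terms, and the stepsize makes every coefficient of \<open>\<gamma> F\<close> at
  most \<open>1 / 4\<close>, which is enough. Since \<open>L\<close> is convex in \<open>(x, z)\<close> and affine in \<open>y\<close>, summing over
  the steps and averaging bounds the gap by \<open>D\<^sup>2 / (2 \<gamma> K)\<close>, and \<open>1 / \<gamma>\<close> is at most four times
  the factor in the claim, so \<open>C = 2\<close> works.
\<close>

unbundle no inner_syntax
hide_const (open) Finite_Cartesian_Product.row

section \<open>Euclidean vectors and the largest eigenvalue\<close>

lemma scalar_prod_lessThan:
  "w \<in> carrier_vec m \<Longrightarrow> v \<bullet> w = (\<Sum>i<m. v $ i * w $ i)"
  by (simp add: scalar_prod_def lessThan_atLeast0)

lemma scalar_prod_self_nonneg: "0 \<le> v \<bullet> (v :: real vec)"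
  by (simp add: scalar_prod_def sum_nonneg)

lemma scalar_prod_Cauchy_Schwarz:
  fixes v w :: "real vec"
  assumes "v \<in> carrier_vec m" "w \<in> carrier_vec m"
  shows "(v \<bullet> w)\<^sup>2 \<le> (v \<bullet> v) * (w \<bullet> w)"
  using Cauchy_Schwarz_ineq_sum[of "\<lambda>i. v $ i" "\<lambda>i. w $ i" "{..<m}"]
  by (simp add: scalar_prod_lessThan[OF assms(1)] scalar_prod_lessThan[OF assms(2)] power2_eq_square)

text \<open>The two sides differ by \<open>|v + w|^2\<close>, which is a sum of squares over the
  coordinates.\<close>

lemma scalar_prod_self_diff_le:
  fixes v w :: "real vec"
  assumes "v \<in> carrier_vec m" "w \<in> carrier_vec m"
  shows "(v - w) \<bullet> (v - w) \<le> 2 * (v \<bullet> v + w \<bullet> w)"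
proof -
  have "(\<Sum>i<m. (v $ i - w $ i) * (v $ i - w $ i))
      \<le> (\<Sum>i<m. 2 * (v $ i * v $ i + w $ i * w $ i))"
  proof (rule sum_mono)
    fix i
    show "(v $ i - w $ i) * (v $ i - w $ i) \<le> 2 * (v $ i * v $ i + w $ i * w $ i)"
      using zero_le_square[of "v $ i + w $ i"] by (simp add: algebra_simps)
  qed
  then show ?thesis
    using assms by (simp only: sum.distrib flip: sum_distrib_left)
      (simp add: scalar_prod_lessThan[of _ m])
qed

text \<open>Pairing the summands and using the two-term bound twice gives the factor 4. With
  coefficients of size at most \<open>1 / 4\<close> it leaves \<open>4 / 16\<close> per term, which
  is why the step size carries the factor \<open>1 / 4\<close>.\<close>

lemma scalar_prod_self_sum4_le:
  fixes v1 v2 v3 v4 :: "real vec"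
  assumes c: "v1 \<in> carrier_vec m" "v2 \<in> carrier_vec m" "v3 \<in> carrier_vec m" "v4 \<in> carrier_vec m"
  shows "(v1 + v2 + v3 + v4) \<bullet> (v1 + v2 + v3 + v4)
    \<le> 4 * (v1 \<bullet> v1 + v2 \<bullet> v2 + v3 \<bullet> v3 + v4 \<bullet> v4)"
proof -
  have 2: "(v + w) \<bullet> (v + w) \<le> 2 * (v \<bullet> v + w \<bullet> w)"
    if "v \<in> carrier_vec m" "w \<in> carrier_vec m" for v w :: "real vec"
  proof -
    have "v + w = v - (- w)" using that by auto
    then show ?thesis using scalar_prod_self_diff_le[of v m "- w"] that by simp
  qed
  have "v1 + v2 + v3 + v4 = (v1 + v2) + (v3 + v4)"
    using c by (auto simp: assoc_add_vec[of _ m])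
  then show ?thesis
    using 2[of "v1 + v2" "v3 + v4"] 2[OF c(1,2)] 2[OF c(3,4)] c by simp
qed

text \<open>In the expansion of \<open>|u - \<gamma> gh - w|^2\<close>, the vector
  \<open>u - w\<close> is replaced by \<open>(uh - w) + \<gamma> g\<close>. The remaining
  \<open>\<gamma>^2 |gh|^2 - 2 \<gamma>^2 (gh \<bullet> g)\<close> is completed to a square, at the
  price of \<open>\<gamma>^2 |g|^2 = |uh - u|^2\<close>. The last two terms of the identity are the
  ones that nonexpansiveness compares.\<close>

lemma extragradient_identity:
  fixes u uh u' w g gh :: "real vec"
  assumes c: "u \<in> carrier_vec m" "w \<in> carrier_vec m" "g \<in> carrier_vec m" "gh \<in> carrier_vec m"
    and uh: "uh = u - \<gamma> \<cdot>\<^sub>v g" and u': "u' = u - \<gamma> \<cdot>\<^sub>v gh"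
  shows "(u' - w) \<bullet> (u' - w) = (u - w) \<bullet> (u - w) - 2 * \<gamma> * (gh \<bullet> (uh - w))
    + \<gamma>\<^sup>2 * ((gh - g) \<bullet> (gh - g)) - (uh - u) \<bullet> (uh - u)"
proof -
  have cu: "uh \<in> carrier_vec m" "u' \<in> carrier_vec m" using c uh u' by auto
  have "(\<Sum>i<m. (u' $ i - w $ i) * (u' $ i - w $ i))
      = (\<Sum>i<m. (u $ i - w $ i) * (u $ i - w $ i) - 2 * \<gamma> * (gh $ i * (uh $ i - w $ i))
          + \<gamma>\<^sup>2 * ((gh $ i - g $ i) * (gh $ i - g $ i)) - (uh $ i - u $ i) * (uh $ i - u $ i))"
    using c by (intro sum.cong refl) (simp add: uh u' power2_eq_square algebra_simps)
  then show ?thesis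
    using c cu by (simp only: sum.distrib sum_subtractf flip: sum_distrib_left)
      (simp add: scalar_prod_lessThan[of _ m])
qed

section \<open>Quadratic forms and the largest eigenvalue of a symmetric matrix\<close>

text \<open>Cauchy-Schwarz on every row gives the squared Frobenius norm as a constant; adding 1
  makes it positive even for a zero matrix.\<close>

lemma mult_mat_vec_bounded:
  fixes B :: "real mat"
  assumes B: "B \<in> carrier_mat k m"
  obtains c where "c > 0" "\<And>v. v \<in> carrier_vec m \<Longrightarrow> (B *\<^sub>v v) \<bullet> (B *\<^sub>v v) \<le> c * (v \<bullet> v)"
proof
  define c where "c = (\<Sum>i<k. row B i \<bullet> row B i)"
  have c0: "c \<ge> 0" by (simp add: c_def sum_nonneg scalar_prod_self_nonneg)
  then show "c + 1 > 0" by simp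
  fix v :: "real vec" assume v: "v \<in> carrier_vec m"
  have "(B *\<^sub>v v) \<bullet> (B *\<^sub>v v) = (\<Sum>i<k. (row B i \<bullet> v)\<^sup>2)"
    using B v by (simp add: scalar_prod_lessThan[of _ k] power2_eq_square)
  also have "\<dots> \<le> (\<Sum>i<k. (row B i \<bullet> row B i) * (v \<bullet> v))"
    using B v by (intro sum_mono scalar_prod_Cauchy_Schwarz[of _ m]) auto
  also have "\<dots> \<le> (c + 1) * (v \<bullet> v)"
    by (simp add: c_def algebra_simps scalar_prod_self_nonneg flip: sum_distrib_left)
  finally show "(B *\<^sub>v v) \<bullet> (B *\<^sub>v v) \<le> (c + 1) * (v \<bullet> v)" .
qed

lemma sym_mat_self_adjoint:
  fixes M :: "real mat"
  assumes "M \<in> carrier_mat m m" "M\<^sup>T = M" "v \<in> carrier_vec m" "w \<in> carrier_vec m"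
  shows "v \<bullet> (M *\<^sub>v w) = w \<bullet> (M *\<^sub>v v)"
  using transpose_vec_mult_scalar[OF assms(1,4,3)] assms
    comm_scalar_prod[of "M *\<^sub>v v" m w] by simp

text \<open>The constant comes from evaluating the form at \<open>v - t N v\<close>, where \<open>1 / t\<close> bounds the form.\<close>

lemma psd_mult_vec_le:
  fixes N :: "real mat"
  assumes N: "N \<in> carrier_mat m m" "N\<^sup>T = N"
    and psd: "\<And>v. v \<in> carrier_vec m \<Longrightarrow> 0 \<le> v \<bullet> (N *\<^sub>v v)"
  obtains c where "c > 0" "\<And>v. v \<in> carrier_vec m \<Longrightarrow> (N *\<^sub>v v) \<bullet> (N *\<^sub>v v) \<le> c * (v \<bullet> (N *\<^sub>v v))"
proof -
  obtain c where c: "c > 0" "\<And>v. v \<in> carrier_vec m \<Longrightarrow> (N *\<^sub>v v) \<bullet> (N *\<^sub>v v) \<le> c * (v \<bullet> v)"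
    using mult_mat_vec_bounded[OF N(1)] by blast
  define k where "k = (1 + c) / 2"
  have k: "k > 0" using c by (simp add: k_def)
  \<comment> \<open>Expanding \<open>|w - N w|^2 \<ge> 0\<close> bounds the form by half of
    \<open>|w|^2 + |N w|^2\<close>.\<close>
  have form_le: "w \<bullet> (N *\<^sub>v w) \<le> k * (w \<bullet> w)" if w: "w \<in> carrier_vec m" for w
  proof -
    have Nw: "N *\<^sub>v w \<in> carrier_vec m" using N w by simp
    have "2 * (w \<bullet> (N *\<^sub>v w)) = w \<bullet> w + (N *\<^sub>v w) \<bullet> (N *\<^sub>v w) - (w - N *\<^sub>v w) \<bullet> (w - N *\<^sub>v w)"
      using w Nw by (simp add: minus_scalar_prod_distrib[of _ m] scalar_prod_minus_distrib[of _ m]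
          comm_scalar_prod[of "N *\<^sub>v w" m w])
    also have "\<dots> \<le> w \<bullet> w + c * (w \<bullet> w)"
      using c(2)[OF w] scalar_prod_self_nonneg[of "w - N *\<^sub>v w"] by linarith
    finally show ?thesis by (simp add: k_def algebra_simps)
  qed
  show thesis
  proof (rule that[OF k])
    fix v :: "real vec" assume v: "v \<in> carrier_vec m"
    define w where "w = N *\<^sub>v v"
    have w: "w \<in> carrier_vec m" using N v by (simp add: w_def)
    have Nw: "N *\<^sub>v w \<in> carrier_vec m" using N w by simp
    define t where "t = 1 / k"
    have "0 \<le> (v - t \<cdot>\<^sub>v w) \<bullet> (N *\<^sub>v (v - t \<cdot>\<^sub>v w))"
      using v w by (intro psd) auto
    also have "N *\<^sub>v (v - t \<cdot>\<^sub>v w) = w - t \<cdot>\<^sub>v (N *\<^sub>v w)"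
      using N v w by (simp add: mult_minus_distrib_mat_vec[of _ m m] mult_mat_vec[of _ m m] w_def)
    also have "(v - t \<cdot>\<^sub>v w) \<bullet> (w - t \<cdot>\<^sub>v (N *\<^sub>v w))
        = v \<bullet> w - t * (v \<bullet> (N *\<^sub>v w)) - t * (w \<bullet> w) + t\<^sup>2 * (w \<bullet> (N *\<^sub>v w))"
      using v w Nw by (simp add: minus_scalar_prod_distrib[of _ m] scalar_prod_minus_distrib[of _ m]
          power2_eq_square algebra_simps)
    also have "v \<bullet> (N *\<^sub>v w) = w \<bullet> w"
      using sym_mat_self_adjoint[OF N v w] by (simp add: w_def)
    also have "t\<^sup>2 * (w \<bullet> (N *\<^sub>v w)) \<le> t\<^sup>2 * (k * (w \<bullet> w))"
      by (intro mult_left_mono form_le w) auto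
    \<comment> \<open>Both cross terms equal \<open>t |w|^2\<close> by symmetry of \<open>N\<close>,
      and \<open>t^2 k = t\<close> gives one of them back.\<close>
    finally have "t * (w \<bullet> w) \<le> v \<bullet> w"
      using k by (simp add: t_def power2_eq_square field_simps)
    then show "(N *\<^sub>v v) \<bullet> (N *\<^sub>v v) \<le> k * (v \<bullet> (N *\<^sub>v v))"
      using k by (simp add: t_def w_def field_simps)
  qed
qed

text \<open>
  If \<open>\<mu>\<close>, the supremum of the form on the unit sphere, were not an eigenvalue, then
  \<open>\<mu> - M\<close> would be positive semidefinite and invertible, so its form would be bounded away
  from \<open>0\<close> on the sphere.
\<close>

lemma quadratic_form_le_lambda_max:
  fixes M :: "real mat"
  assumes M: "M \<in> carrier_mat m m" "M\<^sup>T = M" and v: "v \<in> carrier_vec m"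
  shows "v \<bullet> (M *\<^sub>v v) \<le> lambda_max M * (v \<bullet> v)"
proof (cases "m = 0")
  \<comment> \<open>In dimension 0 the spectrum is empty and \<open>lambda_max\<close> unspecified,
    but both sides are multiples of empty sums.\<close>
  case True
  then show ?thesis using v M by (simp add: scalar_prod_def)
next
  case False
  define S where "S = {v \<bullet> (M *\<^sub>v v) | v. v \<in> carrier_vec m \<and> v \<bullet> v = 1}"
  define \<mu> where "\<mu> = Sup S"
  define N where "N = \<mu> \<cdot>\<^sub>m 1\<^sub>m m - M"
  have N: "N \<in> carrier_mat m m" unfolding N_def by (rule minus_carrier_mat[OF M(1)])
  have NT: "N\<^sup>T = N"
  proof (rule eq_matI)
    fix i j assume "i < dim_row N" "j < dim_col N"
    then have ij: "i < m" "j < m" using N by auto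
    then have "M $$ (j, i) = M $$ (i, j)"
      using M index_transpose_mat(1)[of i M j] by auto
    then show "N\<^sup>T $$ (i, j) = N $$ (i, j)"
      using ij M by (simp add: N_def)
  qed (use N in auto)
  have Nv: "N *\<^sub>v v = \<mu> \<cdot>\<^sub>v v - M *\<^sub>v v" if "v \<in> carrier_vec m" for v
  proof -
    have "(\<mu> \<cdot>\<^sub>m 1\<^sub>m m) *\<^sub>v v = \<mu> \<cdot>\<^sub>v v"
      by (rule eq_vecI) (use that in auto)
    then show ?thesis
      using that M by (simp add: N_def minus_mult_distrib_mat_vec[of _ m m])
  qed
  have form: "v \<bullet> (N *\<^sub>v v) = \<mu> * (v \<bullet> v) - v \<bullet> (M *\<^sub>v v)" if "v \<in> carrier_vec m" for v
    using that M by (simp add: Nv scalar_prod_minus_distrib[of _ m])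
  have ne: "S \<noteq> {}"
    using False by (auto simp: S_def intro!: exI[of _ "unit_vec m 0"])
  have bdd: "bdd_above S"
  proof -
    obtain c where c: "\<And>v. v \<in> carrier_vec m \<Longrightarrow> (M *\<^sub>v v) \<bullet> (M *\<^sub>v v) \<le> c * (v \<bullet> v)"
      using mult_mat_vec_bounded[OF M(1)] by blast
    \<comment> \<open>Again from \<open>|v - M v|^2 \<ge> 0\<close>, now with
      \<open>|v| = 1\<close>.\<close>
    have "v \<bullet> (M *\<^sub>v v) \<le> (1 + c) / 2" if v: "v \<in> carrier_vec m" "v \<bullet> v = 1" for v
    proof -
      have Mv: "M *\<^sub>v v \<in> carrier_vec m" using M v by simp
      have "2 * (v \<bullet> (M *\<^sub>v v)) = v \<bullet> v + (M *\<^sub>v v) \<bullet> (M *\<^sub>v v) - (v - M *\<^sub>v v) \<bullet> (v - M *\<^sub>v v)"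
        using v Mv by (simp add: minus_scalar_prod_distrib[of _ m] scalar_prod_minus_distrib[of _ m]
            comm_scalar_prod[of "M *\<^sub>v v" m v])
      then show ?thesis
        using c[OF v(1)] scalar_prod_self_nonneg[of "v - M *\<^sub>v v"] v by simp
    qed
    then show ?thesis
      by (intro bdd_aboveI[of _ "(1 + c) / 2"]) (auto simp: S_def simp del: le_divide_eq_numeral1)
  qed
  have le: "v \<bullet> (M *\<^sub>v v) \<le> \<mu> * (v \<bullet> v)" if v: "v \<in> carrier_vec m" for v
  proof (cases "v \<bullet> v = 0")
    case True
    then have "v = 0\<^sub>v m"
      using v by (auto simp: scalar_prod_lessThan sum_nonneg_eq_0_iff)
    then show ?thesis using M by simp
  next
    case False
    define a where "a = v \<bullet> v"
    have a: "a > 0" using False scalar_prod_self_nonneg[of v] by (simp add: a_def)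
    \<comment> \<open>Both sides are homogeneous of degree 2, so a nonzero \<open>v\<close> may be
      scaled onto the unit sphere.\<close>
    define w where "w = (1 / sqrt a) \<cdot>\<^sub>v v"
    have w: "w \<in> carrier_vec m" using v by (simp add: w_def)
    have "w \<bullet> w = 1" using a v by (simp add: w_def flip: a_def)
    then have "w \<bullet> (M *\<^sub>v w) \<le> \<mu>"
      unfolding \<mu>_def using w by (intro cSup_upper bdd) (auto simp: S_def)
    moreover have "w \<bullet> (M *\<^sub>v w) = v \<bullet> (M *\<^sub>v v) / a"
      using v M a by (simp add: w_def mult_mat_vec[of _ m m])
    ultimately show ?thesis using a by (simp add: field_simps flip: a_def)
  qed
  have "eigenvalue M \<mu>"
  proof (rule ccontr)
    assume "\<not> eigenvalue M \<mu>"
    then have "det (char_matrix M \<mu>) \<noteq> 0" using eigenvalue_det[OF M(1)] by simp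
    then obtain B where B: "B \<in> carrier_mat m m" "B * char_matrix M \<mu> = 1\<^sub>m m"
      using det_non_zero_imp_unit[of "char_matrix M \<mu>" m "()"] char_matrix_closed[OF M(1)]
      unfolding Units_def ring_mat_def by auto
    \<comment> \<open>The left inverse \<open>B\<close> of this matrix recovers \<open>v\<close>
      from \<open>- N v\<close>, so \<open>|N v|\<close> cannot be small on the sphere.\<close>
    have char: "char_matrix M \<mu> = - N"
      by (rule eq_matI) (use M in \<open>auto simp: char_matrix_def N_def\<close>)
    obtain c where c: "c > 0"
      "\<And>v. v \<in> carrier_vec m \<Longrightarrow> (N *\<^sub>v v) \<bullet> (N *\<^sub>v v) \<le> c * (v \<bullet> (N *\<^sub>v v))"
      using psd_mult_vec_le[OF N NT] form le by (metis diff_ge_0_iff_ge)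
    obtain k where k: "k > 0" "\<And>v. v \<in> carrier_vec m \<Longrightarrow> (B *\<^sub>v v) \<bullet> (B *\<^sub>v v) \<le> k * (v \<bullet> v)"
      using mult_mat_vec_bounded[OF B(1)] by blast
    \<comment> \<open>For a unit vector,
      \<open>1 = |v|^2 \<le> k |N v|^2 \<le> k c (\<mu> - q)\<close>. All values of the form thus
      stay a fixed distance below \<open>\<mu>\<close>, which contradicts
      \<open>\<mu> = Sup S\<close>.\<close>
    have "q \<le> \<mu> - 1 / (k * c)" if q: "q \<in> S" for q
    proof -
      obtain v where v: "v \<in> carrier_vec m" "v \<bullet> v = 1" "q = v \<bullet> (M *\<^sub>v v)"
        using q unfolding S_def by blast
      have Nvc: "N *\<^sub>v v \<in> carrier_vec m" using N v by simp
      have "v = (B * char_matrix M \<mu>) *\<^sub>v v" using v B by simp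
      also have "\<dots> = B *\<^sub>v (char_matrix M \<mu> *\<^sub>v v)"
        using B v char_matrix_closed[OF M(1)] by (intro assoc_mult_mat_vec) auto
      also have "char_matrix M \<mu> *\<^sub>v v = - (N *\<^sub>v v)"
        unfolding char using N v by simp
      finally have "v \<bullet> v = (B *\<^sub>v (- (N *\<^sub>v v))) \<bullet> (B *\<^sub>v (- (N *\<^sub>v v)))" by simp
      also have "\<dots> \<le> k * ((- (N *\<^sub>v v)) \<bullet> (- (N *\<^sub>v v)))"
        using Nvc by (intro k) auto
      also have "\<dots> = k * ((N *\<^sub>v v) \<bullet> (N *\<^sub>v v))" using Nvc by simp
      also have "\<dots> \<le> k * (c * (v \<bullet> (N *\<^sub>v v)))"
        using k c v by (intro mult_left_mono) auto
      finally have "1 \<le> k * c * (\<mu> - q)"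
        using v form[of v] by simp
      then show ?thesis using k c by (simp add: field_simps)
    qed
    then have "\<mu> \<le> \<mu> - 1 / (k * c)"
      unfolding \<mu>_def using ne by (intro cSup_least) auto
    then show False using k c by (simp add: divide_le_0_iff mult_le_0_iff)
  qed
  then have "\<mu> \<le> lambda_max M"
    unfolding lambda_max_def
    by (intro Max_ge card_finite_spectrum(1)[OF M(1)]) (simp add: spectrum_def)
  then show ?thesis
    using le[OF v] mult_right_mono[OF _ scalar_prod_self_nonneg] order_trans by blast
qed

text \<open>\<open>|A v|^2\<close> is the quadratic form of the symmetric matrix
  \<open>A\<^sup>T * A\<close> at \<open>v\<close>.\<close>

lemma mult_mat_vec_le_lambda_max:
  fixes A :: "real mat"
  assumes A: "A \<in> carrier_mat s m" and v: "v \<in> carrier_vec m"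
  shows "(A *\<^sub>v v) \<bullet> (A *\<^sub>v v) \<le> lambda_max (A\<^sup>T * A) * (v \<bullet> v)"
proof -
  have Av: "A *\<^sub>v v \<in> carrier_vec s" using A v by simp
  have "(A *\<^sub>v v) \<bullet> (A *\<^sub>v v) = (A\<^sup>T *\<^sub>v (A *\<^sub>v v)) \<bullet> v"
    using transpose_vec_mult_scalar[OF A v Av] by simp
  also have "\<dots> = v \<bullet> (A\<^sup>T *\<^sub>v (A *\<^sub>v v))"
    using A v Av by (intro comm_scalar_prod[of _ m]) auto
  also have "\<dots> = v \<bullet> ((A\<^sup>T * A) *\<^sub>v v)"
    using A v assoc_mult_mat_vec[of "A\<^sup>T" m s A m v] by simp
  also have "\<dots> \<le> lambda_max (A\<^sup>T * A) * (v \<bullet> v)"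
    using A v by (intro quadratic_form_le_lambda_max) (auto simp: transpose_mult[of _ m s])
  finally show ?thesis .
qed

text \<open>A matrix and its transpose have the same operator norm: with
  \<open>v = A\<^sup>T *\<^sub>v w\<close>, Cauchy-Schwarz gives
  \<open>|v|^4 = (w \<bullet> A v)^2 \<le> |w|^2 c |v|^2\<close>, and \<open>|v|^2\<close>
  cancels.\<close>

lemma mult_transpose_vec_le:
  fixes A :: "real mat"
  assumes A: "A \<in> carrier_mat s m" and w: "w \<in> carrier_vec s"
    and bound: "\<And>v. v \<in> carrier_vec m \<Longrightarrow> (A *\<^sub>v v) \<bullet> (A *\<^sub>v v) \<le> c * (v \<bullet> v)"
    and c: "c \<ge> 0"
  shows "(A\<^sup>T *\<^sub>v w) \<bullet> (A\<^sup>T *\<^sub>v w) \<le> c * (w \<bullet> w)"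
proof -
  define v where "v = A\<^sup>T *\<^sub>v w"
  have v: "v \<in> carrier_vec m" using A w by (simp add: v_def)
  have Av: "A *\<^sub>v v \<in> carrier_vec s" using A v by simp
  have "v \<bullet> v = w \<bullet> (A *\<^sub>v v)"
    using transpose_vec_mult_scalar[OF A v w] by (simp add: v_def)
  then have "(v \<bullet> v)\<^sup>2 \<le> (w \<bullet> w) * ((A *\<^sub>v v) \<bullet> (A *\<^sub>v v))"
    using scalar_prod_Cauchy_Schwarz[OF w Av] by simp
  also have "\<dots> \<le> (w \<bullet> w) * (c * (v \<bullet> v))"
    by (intro mult_left_mono bound v scalar_prod_self_nonneg)
  finally have "(v \<bullet> v) * (v \<bullet> v) \<le> (c * (w \<bullet> w)) * (v \<bullet> v)"
    by (simp add: power2_eq_square algebra_simps)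
  \<comment> \<open>For \<open>v = 0\<close> there is nothing to cancel, and the claim is that the
    right-hand side is nonnegative.\<close>
  then have "v \<bullet> v \<le> c * (w \<bullet> w)"
    using c scalar_prod_self_nonneg[of v] scalar_prod_self_nonneg[of w]
    by (cases "v \<bullet> v = 0") (auto simp: mult_le_cancel_right)
  then show ?thesis by (simp add: v_def)
qed

section \<open>Norms, the gradient inequality and averages\<close>

lemma add_diff_add_vec:
  fixes a b u v :: "real vec"
  assumes "a \<in> carrier_vec m" "b \<in> carrier_vec m" "u \<in> carrier_vec m" "v \<in> carrier_vec m"
  shows "(a + b) - (u + v) = (a - u) + (b - v)"
  by (rule eq_vecI) (use assms in auto)

lemma vnorm_eq_sqrt: "vnorm v = sqrt (v \<bullet> v)"
  by (simp add: vnorm_def L2_set_def scalar_prod_def power2_eq_square lessThan_atLeast0)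

lemma vnorm_nonneg: "0 \<le> vnorm v"
  by (simp add: vnorm_def)

lemma vnorm_smult: "vnorm (t \<cdot>\<^sub>v v) = \<bar>t\<bar> * vnorm v"
  by (simp add: vnorm_eq_sqrt real_sqrt_mult flip: mult.assoc)

text \<open>Along the segment from \<open>u\<close> to \<open>v\<close>, convexity bounds
  \<open>f (u + t w)\<close> above by the chord and differentiability bounds it below by the tangent
  up to \<open>t * e\<close>; dividing by \<open>t\<close> gives the claim up to
  \<open>e\<close>.\<close>

lemma vconvex_gradient_ineq:
  assumes conv: "vconvex m f" and g: "has_vgrad m f u g"
    and u: "u \<in> carrier_vec m" and v: "v \<in> carrier_vec m"
  shows "f u + g \<bullet> (v - u) \<le> f v"
proof (rule field_le_epsilon)
  fix e :: real assume e: "e > 0"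
  define w where "w = v - u"
  \<comment> \<open>The summand 1 keeps \<open>a\<close> positive when \<open>v = u\<close>;
    accuracy \<open>e / a\<close> then makes the linearisation error at \<open>h\<close> at most
    \<open>t * e\<close>.\<close>
  define a where "a = vnorm w + 1"
  have w: "w \<in> carrier_vec m" using u v by (simp add: w_def)
  have gc: "g \<in> carrier_vec m" using g by (simp add: has_vgrad_def)
  have a: "a \<ge> 1" "vnorm w < a" by (auto simp: a_def vnorm_nonneg)
  have ea: "e / a > 0" using e a by simp
  obtain \<delta> where \<delta>: "\<delta> > 0"
    "\<And>h. h \<in> carrier_vec m \<Longrightarrow> vnorm h < \<delta> \<Longrightarrow> \<bar>f (u + h) - f u - g \<bullet> h\<bar> \<le> e / a * vnorm h"
    using g ea unfolding has_vgrad_def by blast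
  \<comment> \<open>The bound 1 makes \<open>u + h\<close> a convex combination; the other bound
    gives \<open>vnorm h \<le> \<delta> / 2\<close>.\<close>
  define t where "t = min 1 (\<delta> / (2 * a))"
  have t: "t > 0" "t \<le> 1" using \<delta> a by (auto simp: t_def)
  define h where "h = t \<cdot>\<^sub>v w"
  have h: "h \<in> carrier_vec m" using w by (simp add: h_def)
  have "vnorm h = t * vnorm w" using t by (simp add: h_def vnorm_smult)
  also have "\<dots> \<le> \<delta> / (2 * a) * a"
    using t a \<delta> vnorm_nonneg[of w] by (intro mult_mono) (auto simp: t_def)
  also have "\<dots> < \<delta>" using \<delta> a by simp
  finally have "\<bar>f (u + h) - f u - g \<bullet> h\<bar> \<le> e / a * vnorm h"
    by (intro \<delta> h)
  also have "\<dots> = t * e * (vnorm w / a)"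
    using t by (simp add: h_def vnorm_smult)
  also have "\<dots> \<le> t * e * 1"
    using t e a by (intro mult_left_mono) auto
  finally have 1: "g \<bullet> h \<le> f (u + h) - f u + t * e" by simp
  have "u + h = t \<cdot>\<^sub>v v + (1 - t) \<cdot>\<^sub>v u"
    by (rule eq_vecI) (use u v in \<open>auto simp: h_def w_def algebra_simps\<close>)
  then have "f (u + h) \<le> t * f v + (1 - t) * f u"
    using conv u v t by (simp add: vconvex_def)
  moreover have "g \<bullet> h = t * (g \<bullet> w)"
    using gc w by (simp add: h_def)
  ultimately have "t * (g \<bullet> w) \<le> t * (f v - f u + e)"
    using 1 by (simp add: algebra_simps)
  then show "f u + g \<bullet> (v - u) \<le> f v + e"
    using t by (simp add: w_def)
qed

lemma vaverage_carrier: "(\<And>k. k < K \<Longrightarrow> v k \<in> carrier_vec m) \<Longrightarrow> vaverage m K v \<in> carrier_vec m"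
  unfolding vaverage_def by (intro smult_carrier_vec[THEN iffD2] finsum_vec_closed) auto

lemma vaverage_index:
  "(\<And>k. k < K \<Longrightarrow> v k \<in> carrier_vec m) \<Longrightarrow> i < m \<Longrightarrow> vaverage m K v $ i = (\<Sum>k<K. v k $ i) / real K"
  using finsum_vec_closed[of v "{..<K}" m]
  by (simp add: vaverage_def index_finsum_vec Pi_def)

lemma scalar_prod_vaverage:
  assumes v: "\<And>k. k < K \<Longrightarrow> v k \<in> carrier_vec m" and w: "w \<in> carrier_vec m"
  shows "w \<bullet> vaverage m K v = (\<Sum>k<K. w \<bullet> v k) / real K"
proof -
  have "w \<bullet> vaverage m K v = (\<Sum>i<m. w $ i * ((\<Sum>k<K. v k $ i) / real K))"
    using v by (simp add: scalar_prod_lessThan[OF vaverage_carrier] vaverage_index)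
  also have "\<dots> = (\<Sum>i<m. \<Sum>k<K. w $ i * v k $ i) / real K"
    by (simp add: sum_distrib_left sum_divide_distrib)
  also have "\<dots> = (\<Sum>k<K. \<Sum>i<m. w $ i * v k $ i) / real K"
    by (subst sum.swap) simp
  also have "\<dots> = (\<Sum>k<K. w \<bullet> v k) / real K"
    using v by (simp add: scalar_prod_lessThan[of _ m])
  finally show ?thesis .
qed

text \<open>Deviations from a mean cancel. This removes the linear terms when a first-order
  inequality at the average is summed, so it serves as Jensen's inequality below.\<close>

lemma sum_scalar_prod_diff_vaverage:
  assumes v: "\<And>k. k < K \<Longrightarrow> v k \<in> carrier_vec m" and w: "w \<in> carrier_vec m"
  shows "(\<Sum>k<K. w \<bullet> (v k - vaverage m K v)) = 0"
proof (cases "K = 0")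
  case False
  have "(\<Sum>k<K. w \<bullet> (v k - vaverage m K v)) = (\<Sum>k<K. w \<bullet> v k - w \<bullet> vaverage m K v)"
    by (intro sum.cong refl scalar_prod_minus_distrib[OF w] vaverage_carrier) (use v in auto)
  then show ?thesis
    using False scalar_prod_vaverage[OF v w] by (simp add: sum_subtractf)
qed simp

section \<open>Extragradient steps on an augmented Lagrangian\<close>

text \<open>Here \<open>f\<close> stands for the sum of the regularisers and \<open>h\<close> for
  the loss. Convexity and smoothness enter as first-order lower bounds and squared Lipschitz bounds,
  and \<open>lam\<close> as a bound on the squared operator norm, so the convergence argument is
  free of blocks, limits and eigenvalues.\<close>

locale augmented_lagrangian =
  fixes m s :: nat and A :: "real mat" and f h :: "real vec \<Rightarrow> real"
    and gf gh :: "real vec \<Rightarrow> real vec" and \<rho> lam Lf Lh :: real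
  assumes A: "A \<in> carrier_mat s m"
    and gf: "u \<in> carrier_vec m \<Longrightarrow> gf u \<in> carrier_vec m"
    and gh: "z \<in> carrier_vec s \<Longrightarrow> gh z \<in> carrier_vec s"
    and f_lower: "u \<in> carrier_vec m \<Longrightarrow> v \<in> carrier_vec m \<Longrightarrow> f u + gf u \<bullet> (v - u) \<le> f v"
    and h_lower: "z \<in> carrier_vec s \<Longrightarrow> z' \<in> carrier_vec s \<Longrightarrow> h z + gh z \<bullet> (z' - z) \<le> h z'"
    and gf_lipschitz: "u \<in> carrier_vec m \<Longrightarrow> v \<in> carrier_vec m \<Longrightarrow>
      (gf u - gf v) \<bullet> (gf u - gf v) \<le> Lf\<^sup>2 * ((u - v) \<bullet> (u - v))"
    and gh_lipschitz: "z \<in> carrier_vec s \<Longrightarrow> z' \<in> carrier_vec s \<Longrightarrow>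
      (gh z - gh z') \<bullet> (gh z - gh z') \<le> Lh\<^sup>2 * ((z - z') \<bullet> (z - z'))"
    and \<rho>: "\<rho> \<ge> 0" and lam: "lam \<ge> 0"
    and A_bound: "u \<in> carrier_vec m \<Longrightarrow> (A *\<^sub>v u) \<bullet> (A *\<^sub>v u) \<le> lam * (u \<bullet> u)"
begin

section \<open>The saddle operator and its convexity inequalities\<close>

definition Lagr :: "real vec \<Rightarrow> real vec \<Rightarrow> real vec \<Rightarrow> real" where
  "Lagr x z y = h z + f x + y \<bullet> (A *\<^sub>v x - z) + \<rho> / 2 * ((A *\<^sub>v x - z) \<bullet> (A *\<^sub>v x - z))"

text \<open>The gradient of \<open>y \<bullet> c + \<rho> / 2 * |c|^2\<close> with respect to the
  residual \<open>c = A x - z\<close>; both primal gradients contain it through the chain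
  rule.\<close>

definition price :: "real vec \<Rightarrow> real vec \<Rightarrow> real vec \<Rightarrow> real vec" where
  "price x z y = y + \<rho> \<cdot>\<^sub>v (A *\<^sub>v x - z)"

text \<open>\<open>Fx\<close> and \<open>Fz\<close> are the primal components of the operator; the
  dual one, \<open>-(A x - z)\<close>, is written out wherever it occurs.\<close>

definition Fx :: "real vec \<Rightarrow> real vec \<Rightarrow> real vec \<Rightarrow> real vec" where
  "Fx x z y = gf x + A\<^sup>T *\<^sub>v price x z y"

definition Fz :: "real vec \<Rightarrow> real vec \<Rightarrow> real vec \<Rightarrow> real vec" where
  "Fz x z y = gh z - price x z y"

definition state :: "real vec \<Rightarrow> real vec \<Rightarrow> real vec \<Rightarrow> bool" where
  "state x z y \<longleftrightarrow> x \<in> carrier_vec m \<and> z \<in> carrier_vec s \<and> y \<in> carrier_vec s"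

lemma state_carriers:
  assumes "state x z y"
  shows "x \<in> carrier_vec m" "z \<in> carrier_vec s" "y \<in> carrier_vec s"
    "A *\<^sub>v x \<in> carrier_vec s" "A *\<^sub>v x - z \<in> carrier_vec s" "price x z y \<in> carrier_vec s"
    "Fx x z y \<in> carrier_vec m" "Fz x z y \<in> carrier_vec s"
  using assms A gf gh by (auto simp: state_def price_def Fx_def Fz_def)

text \<open>\<open>f\<close> and \<open>h\<close> have their own first-order bounds, and the
  remaining part is a convex quadratic in the residual \<open>q\<close> whose gradient is
  \<open>price\<close>.\<close>

lemma Lagr_lower:
  assumes s: "state x z y" and s': "state x' z' y"
  shows "Lagr x z y + Fx x z y \<bullet> (x' - x) + Fz x z y \<bullet> (z' - z) \<le> Lagr x' z' y"
proof -
  note c = state_carriers[OF s] and c' = state_carriers[OF s']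
  define p where "p = price x z y"
  define q where "q = A *\<^sub>v x - z"
  define q' where "q' = A *\<^sub>v x' - z'"
  have cp: "p \<in> carrier_vec s" "q \<in> carrier_vec s" "q' \<in> carrier_vec s"
    using c c' by (auto simp: p_def q_def q'_def)
  have "(A\<^sup>T *\<^sub>v p) \<bullet> (x' - x) = p \<bullet> (A *\<^sub>v x') - p \<bullet> (A *\<^sub>v x)"
    using c c' cp A transpose_vec_mult_scalar[OF A _ cp(1), of "x' - x"]
    by (simp add: mult_minus_distrib_mat_vec[of _ s m] scalar_prod_minus_distrib[of _ s])
  moreover have "Fx x z y \<bullet> (x' - x) = gf x \<bullet> (x' - x) + (A\<^sup>T *\<^sub>v p) \<bullet> (x' - x)"
    unfolding Fx_def p_def[symmetric]
    by (rule add_scalar_prod_distrib[of _ m]) (use c c' cp A gf in auto)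
  moreover have "Fz x z y \<bullet> (z' - z) = gh z \<bullet> (z' - z) - (p \<bullet> z' - p \<bullet> z)"
    using c c' cp gh unfolding Fz_def p_def[symmetric]
    by (simp add: minus_scalar_prod_distrib[of _ s] scalar_prod_minus_distrib[of p s])
  moreover have "p \<bullet> q' - p \<bullet> q = p \<bullet> (A *\<^sub>v x') - p \<bullet> (A *\<^sub>v x) - (p \<bullet> z' - p \<bullet> z)"
    using c c' cp by (simp add: q_def q'_def scalar_prod_minus_distrib[of p s])
  moreover have "p \<bullet> w = y \<bullet> w + \<rho> * (q \<bullet> w)" if "w \<in> carrier_vec s" for w
    using that c cp by (simp add: p_def price_def add_scalar_prod_distrib[of _ s] flip: q_def)
  then have "p \<bullet> q' - p \<bullet> q = y \<bullet> q' - y \<bullet> q + \<rho> * (q \<bullet> q' - q \<bullet> q)"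
    using cp by (simp add: algebra_simps)
  \<comment> \<open>The tangent bound for the penalty is
    \<open>\<rho> / 2 * |q' - q|^2 \<ge> 0\<close> rearranged.\<close>
  moreover have "\<rho> * (q \<bullet> q' - q \<bullet> q) \<le> \<rho> / 2 * (q' \<bullet> q') - \<rho> / 2 * (q \<bullet> q)"
  proof -
    have "0 \<le> (q' - q) \<bullet> (q' - q)" by (rule scalar_prod_self_nonneg)
    also have "\<dots> = q' \<bullet> q' - 2 * (q \<bullet> q') + q \<bullet> q"
      using cp by (simp add: minus_scalar_prod_distrib[of _ s] scalar_prod_minus_distrib[of _ s]
          comm_scalar_prod[of q' s q])
    finally have "\<rho> / 2 * (2 * (q \<bullet> q' - q \<bullet> q)) \<le> \<rho> / 2 * (q' \<bullet> q' - q \<bullet> q)"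
      using \<rho> by (intro mult_left_mono) auto
    then show ?thesis by (simp add: algebra_simps)
  qed
  ultimately show ?thesis
    using f_lower[OF c(1) c'(1)] h_lower[OF c(2) c'(2)]
    by (simp add: Lagr_def flip: q_def q'_def)
qed

lemma Lagr_affine_dual:
  assumes "state x z y" "y' \<in> carrier_vec s"
  shows "Lagr x z y' = Lagr x z y + (A *\<^sub>v x - z) \<bullet> (y' - y)"
  using state_carriers[OF assms(1)] assms(2)
  by (simp add: Lagr_def scalar_prod_minus_distrib[of _ s]
      comm_scalar_prod[of "A *\<^sub>v x - z" s])

text \<open>With \<open>Lagr x z y\<close> inserted in between, the primal difference is bounded by
  convexity and the dual one is exact by affinity. The right-hand side is the full operator paired
  with the distance to the comparison point.\<close>

lemma Lagr_saddle_le: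
  assumes s: "state x z y" and w: "state x' z' y'"
  shows "Lagr x z y' - Lagr x' z' y
    \<le> Fx x z y \<bullet> (x - x') + Fz x z y \<bullet> (z - z') - (A *\<^sub>v x - z) \<bullet> (y - y')"
proof -
  note c = state_carriers[OF s] and c' = state_carriers[OF w]
  have "state x' z' y" using s w by (simp add: state_def)
  note Lagr_lower[OF s this]
  moreover have flip: "u \<bullet> (v' - v) = - (u \<bullet> (v - v'))"
    if "u \<in> carrier_vec k" "v \<in> carrier_vec k" "v' \<in> carrier_vec k" for u v v' :: "real vec" and k
    using that by (simp add: scalar_prod_minus_distrib[of _ k])
  ultimately show ?thesis
    using Lagr_affine_dual[OF s c'(3)] flip[OF c(7,1) c'(1)] flip[OF c(8,2) c'(2)]
      flip[OF c(5,3) c'(3)] by linarith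
qed

section \<open>Nonexpansiveness of the scaled operator\<close>

text \<open>The increments of \<open>Fx\<close> and \<open>Fz\<close> split into four terms each and
  that of the dual component into two. After multiplication by \<open>\<gamma>^2\<close>, each term
  has one of the coefficients bounded by \<open>1 / 16\<close>.\<close>

lemma operator_lipschitz:
  assumes s: "state x z y" and s': "state x' z' y'"
    and \<gamma>: "\<gamma>\<^sup>2 \<le> 1 / 16" "(\<gamma> * \<rho>)\<^sup>2 \<le> 1 / 16" "\<gamma>\<^sup>2 * lam \<le> 1 / 16" "(\<gamma> * \<rho>)\<^sup>2 * lam \<le> 1 / 16"
      "(\<gamma> * \<rho> * lam)\<^sup>2 \<le> 1 / 16" "(\<gamma> * Lf)\<^sup>2 \<le> 1 / 16" "(\<gamma> * Lh)\<^sup>2 \<le> 1 / 16"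
  shows "\<gamma>\<^sup>2 * ((Fx x' z' y' - Fx x z y) \<bullet> (Fx x' z' y' - Fx x z y))
      + \<gamma>\<^sup>2 * ((Fz x' z' y' - Fz x z y) \<bullet> (Fz x' z' y' - Fz x z y))
      + \<gamma>\<^sup>2 * (((A *\<^sub>v x' - z') - (A *\<^sub>v x - z)) \<bullet> ((A *\<^sub>v x' - z') - (A *\<^sub>v x - z)))
    \<le> (x' - x) \<bullet> (x' - x) + (z' - z) \<bullet> (z' - z) + (y' - y) \<bullet> (y' - y)"
proof -
  note c = state_carriers[OF s] and c' = state_carriers[OF s']
  have AT: "A\<^sup>T \<in> carrier_mat m s" using A by simp
  define dx dz dy where "dx = x' - x" and "dz = z' - z" and "dy = y' - y"
  define Adx where "Adx = A *\<^sub>v dx"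
  have d: "dx \<in> carrier_vec m" "dz \<in> carrier_vec s" "dy \<in> carrier_vec s" "Adx \<in> carrier_vec s"
    using c c' A by (auto simp: dx_def dz_def dy_def Adx_def)
  have Adx: "Adx = A *\<^sub>v x' - A *\<^sub>v x"
    using c c' A by (simp add: Adx_def dx_def mult_minus_distrib_mat_vec[of _ s m])
  define a e b where "a = dx \<bullet> dx" and "e = dy \<bullet> dy" and "b = dz \<bullet> dz"
  have nonneg: "a \<ge> 0" "e \<ge> 0" "b \<ge> 0"
    by (auto simp: a_def e_def b_def scalar_prod_self_nonneg)
  have AT_bound: "(A\<^sup>T *\<^sub>v w) \<bullet> (A\<^sup>T *\<^sub>v w) \<le> lam * (w \<bullet> w)" if "w \<in> carrier_vec s" for w
    by (rule mult_transpose_vec_le[OF A that A_bound lam])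
  have Adx_le: "Adx \<bullet> Adx \<le> lam * a"
    unfolding Adx_def a_def by (rule A_bound[OF d(1)])
  have price_diff: "price x' z' y' - price x z y = dy + \<rho> \<cdot>\<^sub>v Adx + (- \<rho>) \<cdot>\<^sub>v dz"
    unfolding Adx by (rule eq_vecI)
      (use c c' A in \<open>auto simp: price_def dy_def dz_def algebra_simps\<close>)
  have gfd: "gf x' - gf x \<in> carrier_vec m" "gh z' - gh z \<in> carrier_vec s"
    using c c' gf gh by auto

  define t1 t2 t3 where "t1 = A\<^sup>T *\<^sub>v dy" and "t2 = \<rho> \<cdot>\<^sub>v (A\<^sup>T *\<^sub>v Adx)" and "t3 = (- \<rho>) \<cdot>\<^sub>v (A\<^sup>T *\<^sub>v dz)"
  have t: "t1 \<in> carrier_vec m" "t2 \<in> carrier_vec m" "t3 \<in> carrier_vec m"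
    using d AT by (auto simp: t1_def t2_def t3_def)
  have "A\<^sup>T *\<^sub>v (dy + \<rho> \<cdot>\<^sub>v Adx + (- \<rho>) \<cdot>\<^sub>v dz) = t1 + t2 + t3"
    unfolding t1_def t2_def t3_def
    using d AT by (simp only: mult_add_distrib_mat_vec[of _ m s] mult_mat_vec[of _ m s]
        smult_carrier_vec add_carrier_vec)
  then have ATp: "A\<^sup>T *\<^sub>v price x' z' y' - A\<^sup>T *\<^sub>v price x z y = t1 + t2 + t3"
    using mult_minus_distrib_mat_vec[OF AT c'(6) c(6)] price_diff by simp
  have "Fx x' z' y' - Fx x z y = (gf x' - gf x) + (A\<^sup>T *\<^sub>v price x' z' y' - A\<^sup>T *\<^sub>v price x z y)"
    unfolding Fx_def
    by (rule add_diff_add_vec[of _ m]) (use gf[OF c(1)] gf[OF c'(1)] AT c(6) c'(6) in auto)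
  also have "\<dots> = (gf x' - gf x) + t1 + t2 + t3"
    unfolding ATp using t gfd by (simp add: assoc_add_vec[of _ m])
  finally have dFx: "Fx x' z' y' - Fx x z y = (gf x' - gf x) + t1 + t2 + t3" .
  have "t1 \<bullet> t1 \<le> lam * e" unfolding t1_def e_def by (rule AT_bound[OF d(3)])
  \<comment> \<open>The only term with both \<open>A\<close> and its transpose, hence the square of
    \<open>lam\<close>.\<close>
  moreover have "t2 \<bullet> t2 \<le> \<rho>\<^sup>2 * (lam * (lam * a))"
  proof -
    have "t2 \<bullet> t2 = \<rho>\<^sup>2 * ((A\<^sup>T *\<^sub>v Adx) \<bullet> (A\<^sup>T *\<^sub>v Adx))"
      by (simp add: t2_def power2_eq_square)
    also have "\<dots> \<le> \<rho>\<^sup>2 * (lam * (Adx \<bullet> Adx))"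
      by (intro mult_left_mono AT_bound d) auto
    also have "\<dots> \<le> \<rho>\<^sup>2 * (lam * (lam * a))"
      by (intro mult_left_mono Adx_le lam) auto
    finally show ?thesis .
  qed
  moreover have "t3 \<bullet> t3 \<le> \<rho>\<^sup>2 * (lam * b)"
  proof -
    have "t3 \<bullet> t3 = \<rho>\<^sup>2 * ((A\<^sup>T *\<^sub>v dz) \<bullet> (A\<^sup>T *\<^sub>v dz))"
      by (simp add: t3_def power2_eq_square)
    also have "\<dots> \<le> \<rho>\<^sup>2 * (lam * b)"
      unfolding b_def by (intro mult_left_mono AT_bound d) auto
    finally show ?thesis .
  qed
  moreover have "(gf x' - gf x) \<bullet> (gf x' - gf x) \<le> Lf\<^sup>2 * a"
    unfolding a_def dx_def by (rule gf_lipschitz[OF c'(1) c(1)])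
  ultimately have
    "4 * ((gf x' - gf x) \<bullet> (gf x' - gf x) + t1 \<bullet> t1 + t2 \<bullet> t2 + t3 \<bullet> t3)
      \<le> 4 * (Lf\<^sup>2 * a + lam * e + \<rho>\<^sup>2 * (lam * (lam * a)) + \<rho>\<^sup>2 * (lam * b))"
    by (intro mult_left_mono add_mono) auto
  then have Fx_le: "(Fx x' z' y' - Fx x z y) \<bullet> (Fx x' z' y' - Fx x z y)
      \<le> 4 * (Lf\<^sup>2 * a + lam * e + \<rho>\<^sup>2 * (lam * (lam * a)) + \<rho>\<^sup>2 * (lam * b))"
    unfolding dFx by (rule order_trans[OF scalar_prod_self_sum4_le[OF gfd(1) t]])

  \<comment> \<open>Signs are carried by the scalars so that the increment is literally a sum of
    four vectors.\<close>
  have dFz: "Fz x' z' y' - Fz x z y = (gh z' - gh z) + (- 1) \<cdot>\<^sub>v dy + (- \<rho>) \<cdot>\<^sub>v Adx + \<rho> \<cdot>\<^sub>v dz"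
    unfolding Adx by (rule eq_vecI)
      (use c c' A gh[OF c(2)] gh[OF c'(2)] in \<open>auto simp: Fz_def price_def dy_def dz_def algebra_simps\<close>)
  have "(gh z' - gh z) \<bullet> (gh z' - gh z) \<le> Lh\<^sup>2 * b"
    unfolding b_def dz_def by (rule gh_lipschitz[OF c'(2) c(2)])
  moreover have "((- 1) \<cdot>\<^sub>v dy) \<bullet> ((- 1) \<cdot>\<^sub>v dy) \<le> e" by (simp add: e_def)
  moreover have "((- \<rho>) \<cdot>\<^sub>v Adx) \<bullet> ((- \<rho>) \<cdot>\<^sub>v Adx) \<le> \<rho>\<^sup>2 * (lam * a)"
    using mult_left_mono[OF Adx_le, of "\<rho>\<^sup>2"] by (simp add: power2_eq_square mult.assoc)
  moreover have "(\<rho> \<cdot>\<^sub>v dz) \<bullet> (\<rho> \<cdot>\<^sub>v dz) \<le> \<rho>\<^sup>2 * b" by (simp add: b_def power2_eq_square)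
  ultimately have
    "4 * ((gh z' - gh z) \<bullet> (gh z' - gh z) + ((- 1) \<cdot>\<^sub>v dy) \<bullet> ((- 1) \<cdot>\<^sub>v dy)
        + ((- \<rho>) \<cdot>\<^sub>v Adx) \<bullet> ((- \<rho>) \<cdot>\<^sub>v Adx) + (\<rho> \<cdot>\<^sub>v dz) \<bullet> (\<rho> \<cdot>\<^sub>v dz))
      \<le> 4 * (Lh\<^sup>2 * b + e + \<rho>\<^sup>2 * (lam * a) + \<rho>\<^sup>2 * b)"
    by (intro mult_left_mono add_mono) auto
  then have Fz_le: "(Fz x' z' y' - Fz x z y) \<bullet> (Fz x' z' y' - Fz x z y)
      \<le> 4 * (Lh\<^sup>2 * b + e + \<rho>\<^sup>2 * (lam * a) + \<rho>\<^sup>2 * b)"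
    unfolding dFz
    by (rule order_trans[OF scalar_prod_self_sum4_le[of _ s], rotated -1]) (use gfd d in auto)

  have dFy: "(A *\<^sub>v x' - z') - (A *\<^sub>v x - z) = Adx - dz"
    unfolding Adx by (rule eq_vecI) (use c c' A in \<open>auto simp: dz_def\<close>)
  have Fy_le: "((A *\<^sub>v x' - z') - (A *\<^sub>v x - z)) \<bullet> ((A *\<^sub>v x' - z') - (A *\<^sub>v x - z)) \<le> 2 * (lam * a + b)"
    unfolding dFy using scalar_prod_self_diff_le[OF d(4,2)] Adx_le by (simp add: b_def)

  note scale = mult_left_mono[OF _ zero_le_power2[of \<gamma>]]
  have small: "c * u \<le> u / 16" if "c \<le> 1 / 16" "u \<ge> 0" for c u :: real
    using mult_right_mono[OF that] by simp
  have "\<gamma>\<^sup>2 * ((Fx x' z' y' - Fx x z y) \<bullet> (Fx x' z' y' - Fx x z y))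
      \<le> \<gamma>\<^sup>2 * (4 * (Lf\<^sup>2 * a + lam * e + \<rho>\<^sup>2 * (lam * (lam * a)) + \<rho>\<^sup>2 * (lam * b)))"
    by (rule scale[OF Fx_le])
  \<comment> \<open>Regrouped so that every coefficient is one of those in the assumptions on
    \<open>\<gamma>\<close>.\<close>
  also have "\<dots>
      = 4 * ((\<gamma> * Lf)\<^sup>2 * a + \<gamma>\<^sup>2 * lam * e + (\<gamma> * \<rho> * lam)\<^sup>2 * a + (\<gamma> * \<rho>)\<^sup>2 * lam * b)"
    by (simp add: power2_eq_square algebra_simps)
  also have "\<dots> \<le> 4 * (a / 16 + e / 16 + a / 16 + b / 16)"
    by (intro mult_left_mono add_mono small \<gamma> nonneg) simp
  finally have 1: "\<gamma>\<^sup>2 * ((Fx x' z' y' - Fx x z y) \<bullet> (Fx x' z' y' - Fx x z y))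
      \<le> 4 * (a / 16 + e / 16 + a / 16 + b / 16)" .
  have "\<gamma>\<^sup>2 * ((Fz x' z' y' - Fz x z y) \<bullet> (Fz x' z' y' - Fz x z y))
      \<le> \<gamma>\<^sup>2 * (4 * (Lh\<^sup>2 * b + e + \<rho>\<^sup>2 * (lam * a) + \<rho>\<^sup>2 * b))"
    by (rule scale[OF Fz_le])
  also have "\<dots>
      = 4 * ((\<gamma> * Lh)\<^sup>2 * b + \<gamma>\<^sup>2 * e + (\<gamma> * \<rho>)\<^sup>2 * lam * a + (\<gamma> * \<rho>)\<^sup>2 * b)"
    by (simp add: power2_eq_square algebra_simps)
  also have "\<dots> \<le> 4 * (b / 16 + e / 16 + a / 16 + b / 16)"
    by (intro mult_left_mono add_mono small \<gamma> nonneg) simp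
  finally have 2: "\<gamma>\<^sup>2 * ((Fz x' z' y' - Fz x z y) \<bullet> (Fz x' z' y' - Fz x z y))
      \<le> 4 * (b / 16 + e / 16 + a / 16 + b / 16)" .
  have "\<gamma>\<^sup>2 * (((A *\<^sub>v x' - z') - (A *\<^sub>v x - z)) \<bullet> ((A *\<^sub>v x' - z') - (A *\<^sub>v x - z)))
      \<le> \<gamma>\<^sup>2 * (2 * (lam * a + b))"
    by (rule scale[OF Fy_le])
  also have "\<dots> = 2 * (\<gamma>\<^sup>2 * lam * a + \<gamma>\<^sup>2 * b)"
    by (simp add: algebra_simps)
  also have "\<dots> \<le> 2 * (a / 16 + b / 16)"
    by (intro mult_left_mono add_mono small \<gamma> nonneg) simp
  finally have 3: "\<gamma>\<^sup>2 * (((A *\<^sub>v x' - z') - (A *\<^sub>v x - z)) \<bullet> ((A *\<^sub>v x' - z') - (A *\<^sub>v x - z)))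
      \<le> 2 * (a / 16 + b / 16)" .
  \<comment> \<open>The totals are \<open>14 / 16\<close> for \<open>a\<close> and for
    \<open>b\<close> and \<open>8 / 16\<close> for \<open>e\<close>, all below 1.\<close>
  show ?thesis
    by (rule order_trans[OF add_mono[OF add_mono[OF 1 2] 3]])
      (use nonneg in \<open>simp flip: a_def b_def e_def dx_def dz_def dy_def\<close>)
qed

section \<open>Telescoping and averaging\<close>

lemma extragradient_gap:
  assumes \<gamma>0: "\<gamma> > 0"
    and \<gamma>: "\<gamma>\<^sup>2 \<le> 1 / 16" "(\<gamma> * \<rho>)\<^sup>2 \<le> 1 / 16" "\<gamma>\<^sup>2 * lam \<le> 1 / 16" "(\<gamma> * \<rho>)\<^sup>2 * lam \<le> 1 / 16"
      "(\<gamma> * \<rho> * lam)\<^sup>2 \<le> 1 / 16" "(\<gamma> * Lf)\<^sup>2 \<le> 1 / 16" "(\<gamma> * Lh)\<^sup>2 \<le> 1 / 16"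
    and K: "K > 0"
    and st: "\<And>k. k \<le> K \<Longrightarrow> state (x k) (z k) (y k)"
    and sth: "\<And>k. k < K \<Longrightarrow> state (xh k) (zh k) (yh k)"
    and xh: "\<And>k. k < K \<Longrightarrow> xh k = x k - \<gamma> \<cdot>\<^sub>v Fx (x k) (z k) (y k)"
    and zh: "\<And>k. k < K \<Longrightarrow> zh k = z k - \<gamma> \<cdot>\<^sub>v Fz (x k) (z k) (y k)"
    and yh: "\<And>k. k < K \<Longrightarrow> yh k = y k + \<gamma> \<cdot>\<^sub>v (A *\<^sub>v x k - z k)"
    and x: "\<And>k. k < K \<Longrightarrow> x (Suc k) = x k - \<gamma> \<cdot>\<^sub>v Fx (xh k) (zh k) (yh k)"
    and z: "\<And>k. k < K \<Longrightarrow> z (Suc k) = z k - \<gamma> \<cdot>\<^sub>v Fz (xh k) (zh k) (yh k)"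
    and y: "\<And>k. k < K \<Longrightarrow> y (Suc k) = y k + \<gamma> \<cdot>\<^sub>v (A *\<^sub>v xh k - zh k)"
    and w: "state x' z' y'"
  shows "Lagr (vaverage m K xh) (vaverage s K zh) y' - Lagr x' z' (vaverage s K yh)
    \<le> ((x 0 - x') \<bullet> (x 0 - x') + (z 0 - z') \<bullet> (z 0 - z') + (y 0 - y') \<bullet> (y 0 - y')) / (2 * \<gamma> * real K)"
proof -
  define D where "D k = (x k - x') \<bullet> (x k - x') + (z k - z') \<bullet> (z k - z') + (y k - y') \<bullet> (y k - y')" for k
  note c' = state_carriers[OF w]
  have step: "2 * \<gamma> * (Lagr (xh k) (zh k) y' - Lagr x' z' (yh k)) \<le> D k - D (Suc k)" if k: "k < K" for k
  proof -
    note c = state_carriers[OF st[OF less_imp_le[OF k]]] and ch = state_carriers[OF sth[OF k]]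
    define px pz py where "px = Fx (xh k) (zh k) (yh k) \<bullet> (xh k - x')"
      and "pz = Fz (xh k) (zh k) (yh k) \<bullet> (zh k - z')"
      and "py = (A *\<^sub>v xh k - zh k) \<bullet> (yh k - y')"
    \<comment> \<open>The dual update is an ascent step, so the identity is used with
      \<open>- \<gamma>\<close>: the linear term changes sign and \<open>\<gamma>^2\<close>
      stays.\<close>
    have minus: "u + \<gamma> \<cdot>\<^sub>v v = u - (- \<gamma>) \<cdot>\<^sub>v v" if "u \<in> carrier_vec s" "v \<in> carrier_vec s" for u v
      by (rule eq_vecI) (use that in auto)
    note extragradient_identity[OF c(1) c'(1) c(7) ch(7) xh[OF k] x[OF k]]
      extragradient_identity[OF c(2) c'(2) c(8) ch(8) zh[OF k] z[OF k]]
      extragradient_identity[OF c(3) c'(3) c(5) ch(5) yh[OF k, unfolded minus[OF c(3,5)]]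
        y[OF k, unfolded minus[OF c(3) ch(5)]]]
    note ids = this[folded px_def pz_def py_def]
    \<comment> \<open>In the sum of the three identities, nonexpansiveness makes the squared
      operator increments at most the squared distance from step \<open>k\<close> to its half step,
      so the remainder is nonpositive.\<close>
    have "D (Suc k) \<le> D k - 2 * \<gamma> * px - 2 * \<gamma> * pz + 2 * \<gamma> * py"
      using ids operator_lipschitz[OF st[OF less_imp_le[OF k]] sth[OF k] \<gamma>]
      by (simp add: D_def)
    moreover have "2 * \<gamma> * (Lagr (xh k) (zh k) y' - Lagr x' z' (yh k)) \<le> 2 * \<gamma> * (px + pz - py)"
      using Lagr_saddle_le[OF sth[OF k] w] \<gamma>0
      by (intro mult_left_mono) (auto simp: px_def pz_def py_def)
    ultimately show ?thesis by (simp add: algebra_simps)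
  qed
  have "2 * \<gamma> * (\<Sum>k<K. Lagr (xh k) (zh k) y' - Lagr x' z' (yh k)) \<le> (\<Sum>k<K. D k - D (Suc k))"
    unfolding sum_distrib_left by (intro sum_mono step) simp
  also have "\<dots> = D 0 - D K" by (rule sum_lessThan_telescope')
  also have "\<dots> \<le> D 0" 
    using scalar_prod_self_nonneg[of "x K - x'"] scalar_prod_self_nonneg[of "z K - z'"]
      scalar_prod_self_nonneg[of "y K - y'"] by (simp add: D_def)
  finally have regret: "2 * \<gamma> * (\<Sum>k<K. Lagr (xh k) (zh k) y' - Lagr x' z' (yh k)) \<le> D 0" .

  define xa za ya where "xa = vaverage m K xh" and "za = vaverage s K zh" and "ya = vaverage s K yh"
  have ch: "xh k \<in> carrier_vec m" "zh k \<in> carrier_vec s" "yh k \<in> carrier_vec s" if "k < K" for k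
    using sth[OF that] by (auto simp: state_def)
  have sa: "state xa za y'"
    using ch c' by (auto simp: state_def xa_def za_def intro!: vaverage_carrier)
  note ca = state_carriers[OF sa]
  have ya: "ya \<in> carrier_vec s" using ch by (auto simp: ya_def intro!: vaverage_carrier)
  \<comment> \<open>Jensen's inequality in the primal variables: the linear terms at the average add
    up to 0, and each summand is a lower bound at an iterate.\<close>
  have "real K * Lagr xa za y' = (\<Sum>k<K. Lagr xa za y' + Fx xa za y' \<bullet> (xh k - xa) + Fz xa za y' \<bullet> (zh k - za))"
    using sum_scalar_prod_diff_vaverage[of K xh, OF ch(1) ca(7)]
      sum_scalar_prod_diff_vaverage[of K zh, OF ch(2) ca(8)]
    by (simp add: sum.distrib xa_def za_def)
  also have "\<dots> \<le> (\<Sum>k<K. Lagr (xh k) (zh k) y')"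
    using ch c' by (intro sum_mono Lagr_lower sa) (auto simp: state_def)
  finally have upper: "real K * Lagr xa za y' \<le> (\<Sum>k<K. Lagr (xh k) (zh k) y')" .
  have "state x' z' ya" using c' ya by (simp add: state_def)
  \<comment> \<open>In the dual variable the Lagrangian is affine, so averaging is exact.\<close>
  then have "(\<Sum>k<K. Lagr x' z' (yh k)) = (\<Sum>k<K. Lagr x' z' ya + (A *\<^sub>v x' - z') \<bullet> (yh k - ya))"
    using ch by (intro sum.cong refl Lagr_affine_dual) auto
  also have "\<dots> = real K * Lagr x' z' ya"
    using sum_scalar_prod_diff_vaverage[of K yh, OF ch(3) c'(5)] by (simp add: sum.distrib ya_def)
  finally have avg: "real K * (Lagr xa za y' - Lagr x' z' ya)
      \<le> (\<Sum>k<K. Lagr (xh k) (zh k) y' - Lagr x' z' (yh k))"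
    using upper by (simp add: sum_subtractf right_diff_distrib)
  have "2 * \<gamma> * (real K * (Lagr xa za y' - Lagr x' z' ya)) \<le> D 0"
    by (rule order_trans[OF mult_left_mono[OF avg] regret]) (use \<gamma>0 in simp)
  then have "Lagr xa za y' - Lagr x' z' ya \<le> D 0 / (2 * \<gamma> * real K)"
    using \<gamma>0 K by (simp add: field_simps)
  then show ?thesis by (simp add: xa_def za_def ya_def D_def)
qed

end

section \<open>Step size, distances and blocks\<close>

text \<open>Taking reciprocals reverses the order of nonnegative extended reals, so the least
  reciprocal belongs to the largest entry. That entry is at least 1, so the result is finite
  although zero entries contribute infinity.\<close>

lemma stepsize_eq:
  assumes "\<rho> \<ge> 0" "lam \<ge> 0" "Lr \<ge> 0" "Ll \<ge> 0"
  shows "stepsize \<rho> lam Lr Ll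
    = 1 / (4 * Max {1, \<rho>, sqrt lam, sqrt (\<rho> * lam), \<rho> * lam, Lr, Ll})"
proof -
  define S where "S = {1, \<rho>, sqrt lam, sqrt (\<rho> * lam), \<rho> * lam, Lr, Ll}"
  have fin: "finite S" and nonneg: "\<And>a. a \<in> S \<Longrightarrow> a \<ge> 0"
    using assms by (auto simp: S_def)
  have ge: "a \<le> Max S" if "a \<in> S" for a using fin that by simp
  have M: "Max S \<ge> 1" by (rule ge) (simp add: S_def)
  have "Min ((\<lambda>a. 1 / ereal a) ` S) = 1 / ereal (Max S)"
  proof (rule Min_eqI)
    fix q assume "q \<in> (\<lambda>a. 1 / ereal a) ` S"
    then obtain a where a: "a \<in> S" "q = 1 / ereal a" by auto
    show "1 / ereal (Max S) \<le> q"
    proof (cases "a = 0")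
      case False
      then have "0 < a" "a \<le> Max S" using nonneg[OF a(1)] ge[OF a(1)] by auto
      then show ?thesis using M a by (simp add: one_ereal_def frac_le)
    qed (use a stepsize_entry_at_0 in simp)
  next
    show "1 / ereal (Max S) \<in> (\<lambda>a. 1 / ereal a) ` S"
      using fin by (intro imageI Max_in) (auto simp: S_def)
  qed (use fin in simp)
  also have "\<dots> = ereal (1 / Max S)" using M by (simp add: one_ereal_def)
  finally have Min: "Min ((\<lambda>a. 1 / ereal a) ` S) = ereal (1 / Max S)" .
  \<comment> \<open>The plain entry 1 of the minimum has to be read as a reciprocal too.\<close>
  have "1 / ereal 1 = 1" by (simp add: one_ereal_def)
  then have img: "{1, 1 / ereal \<rho>, 1 / ereal (sqrt lam), 1 / ereal (sqrt (\<rho> * lam)),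
      1 / ereal (\<rho> * lam), 1 / ereal Lr, 1 / ereal Ll} = (\<lambda>a. 1 / ereal a) ` S"
    by (simp only: S_def image_insert image_empty)
  have "stepsize \<rho> lam Lr Ll = 1 / 4 * (1 / Max S)"
    unfolding stepsize_def img Min by simp
  also have "\<dots> = 1 / (4 * Max S)" by simp
  finally show ?thesis unfolding S_def .
qed

section \<open>Distances to compact sets and gradients of smooth functions\<close>

text \<open>A compact set lies in some ball, and the triangle inequality through its centre moves
  the bound to \<open>x0\<close>.\<close>

lemma vcompact_sq_dist_bounded:
  assumes S: "vcompact m S" and x0: "x0 \<in> carrier_vec m"
  obtains B where "\<And>v. v \<in> S \<Longrightarrow> v \<in> carrier_vec m \<and> (vnorm (x0 - v))\<^sup>2 \<le> B"
proof -
  interpret Metric_space "carrier_vec m" "vdist m" by (rule Metric_space_vdist)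
  have "mbounded S"
    using S compactin_imp_mbounded by (simp add: vcompact_def)
  then obtain c B where B: "S \<subseteq> mcball c B" by (auto simp: mbounded_def)
  show thesis
  proof
    fix v assume "v \<in> S"
    then have v: "c \<in> carrier_vec m" "v \<in> carrier_vec m" "vdist m c v \<le> B"
      using B by (auto simp: in_mcball)
    then have "vnorm (x0 - v) \<le> vdist m x0 c + B"
      using triangle[OF x0 v(1,2)] x0 by (simp flip: vdist_eq_vnorm[of _ m])
    then show "v \<in> carrier_vec m \<and> (vnorm (x0 - v))\<^sup>2 \<le> (vdist m x0 c + B)\<^sup>2"
      using v by (simp add: power_mono vnorm_nonneg)
  qed
qed

text \<open>A real \<open>SUP\<close> is known to dominate its elements once they are bounded above;
  compactness of the three sets supplies the bound.\<close>

lemma sq_dist_le_max_sq_dist: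
  assumes "vcompact m X" "vcompact s Z" "vcompact s Y"
    and "x0 \<in> carrier_vec m" "z0 \<in> carrier_vec s" "y0 \<in> carrier_vec s"
    and "x \<in> X" "z \<in> Z" "y \<in> Y"
  shows "(vnorm (x0 - x))\<^sup>2 + (vnorm (z0 - z))\<^sup>2 + (vnorm (y0 - y))\<^sup>2 \<le> max_sq_dist X Z Y x0 z0 y0"
proof -
  obtain Bx where Bx: "\<And>v. v \<in> X \<Longrightarrow> v \<in> carrier_vec m \<and> (vnorm (x0 - v))\<^sup>2 \<le> Bx"
    by (rule vcompact_sq_dist_bounded[OF assms(1,4)]) blast
  obtain Bz where Bz: "\<And>v. v \<in> Z \<Longrightarrow> v \<in> carrier_vec s \<and> (vnorm (z0 - v))\<^sup>2 \<le> Bz"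
    by (rule vcompact_sq_dist_bounded[OF assms(2,5)]) blast
  obtain By where By: "\<And>v. v \<in> Y \<Longrightarrow> v \<in> carrier_vec s \<and> (vnorm (y0 - v))\<^sup>2 \<le> By"
    by (rule vcompact_sq_dist_bounded[OF assms(3,6)]) blast
  define g where "g = (\<lambda>(x, z, y). (vnorm (x0 - x))\<^sup>2 + (vnorm (z0 - z))\<^sup>2 + (vnorm (y0 - y))\<^sup>2)"
  have "bdd_above (g ` (X \<times> Z \<times> Y))"
    using Bx Bz By by (intro bdd_aboveI[of _ "Bx + Bz + By"]) (auto simp: g_def intro!: add_mono)
  then have "g (x, z, y) \<le> (SUP p\<in>X \<times> Z \<times> Y. g p)"
    using assms by (intro cSUP_upper) auto
  then show ?thesis by (simp add: g_def max_sq_dist_def)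
qed

lemma vsmooth_has_vgrad:
  assumes "vsmooth m L f" "u \<in> carrier_vec m"
  shows "has_vgrad m f u (vgrad m f u)"
  using assms vgrad_eqI unfolding vsmooth_def by metis

lemma vsmooth_vgrad_carrier: "vsmooth m L f \<Longrightarrow> u \<in> carrier_vec m \<Longrightarrow> vgrad m f u \<in> carrier_vec m"
  using vsmooth_has_vgrad by (auto simp: has_vgrad_def)

lemma vsmooth_lipschitz_sq:
  assumes f: "vsmooth m L f" and u: "u \<in> carrier_vec m" and v: "v \<in> carrier_vec m"
  shows "(vgrad m f u - vgrad m f v) \<bullet> (vgrad m f u - vgrad m f v) \<le> L\<^sup>2 * ((u - v) \<bullet> (u - v))"
proof -
  have "vnorm (vgrad m f u - vgrad m f v) \<le> L * vnorm (u - v)"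
    using assms by (simp add: vsmooth_def)
  then have "(vnorm (vgrad m f u - vgrad m f v))\<^sup>2 \<le> (L * vnorm (u - v))\<^sup>2"
    by (intro power_mono vnorm_nonneg)
  then show ?thesis by (simp add: power_mult_distrib vnorm_power2)
qed

section \<open>Block decomposition of vectors and matrices\<close>

lemma total_dim_Suc: "total_dim (Suc n) d = total_dim n d + d n"
  by (simp add: total_dim_def)

lemma total_dim_add_less: "i < n \<Longrightarrow> j < d i \<Longrightarrow> total_dim i d + j < total_dim n d"
  by (induction n) (auto simp: total_dim_Suc less_Suc_eq)

lemma sum_total_dim:
  fixes g :: "nat \<Rightarrow> real"
  shows "(\<Sum>j<total_dim n d. g j) = (\<Sum>i<n. \<Sum>j<d i. g (total_dim i d + j))"
proof (induction n)
  case (Suc n)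
  have "(\<Sum>j<p + q. g j) = (\<Sum>j<p. g j) + (\<Sum>j<q. g (p + j))" for p q
    by (induction q) simp_all
  then show ?case using Suc by (simp add: total_dim_Suc)
qed (simp add: total_dim_def)

lemma block_carrier: "block d x i \<in> carrier_vec (d i)"
  by (simp add: block_def)

lemma scalar_prod_blocks:
  fixes v w :: "real vec"
  assumes "w \<in> carrier_vec (total_dim n d)"
  shows "v \<bullet> w = (\<Sum>i<n. block d v i \<bullet> block d w i)"
  by (simp add: scalar_prod_lessThan[OF assms] sum_total_dim scalar_prod_lessThan[OF block_carrier])
    (simp add: block_def)

text \<open>The dimension of a vector sum is that of its second summand, hence the carrier condition
  on \<open>v\<close>.\<close>

lemma block_add:
  assumes "v \<in> carrier_vec (total_dim n d)" "i < n"
  shows "block d (u + v) i = block d u i + block d v i"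
  by (rule eq_vecI) (use assms total_dim_add_less[OF assms(2)] in \<open>auto simp: block_def\<close>)

lemma block_minus:
  assumes "v \<in> carrier_vec (total_dim n d)" "i < n"
  shows "block d (u - v) i = block d u i - block d v i"
  by (rule eq_vecI) (use assms total_dim_add_less[OF assms(2)] in \<open>auto simp: block_def\<close>)

lemma block_smult:
  assumes "v \<in> carrier_vec (total_dim n d)" "i < n"
  shows "block d (a \<cdot>\<^sub>v v) i = a \<cdot>\<^sub>v block d v i"
  by (rule eq_vecI) (use assms total_dim_add_less[OF assms(2)] in \<open>auto simp: block_def\<close>)

text \<open>The squared norm of \<open>u - v\<close> is the sum of those of its blocks, which all
  vanish.\<close>

lemma block_eqI:
  fixes u v :: "real vec"
  assumes u: "u \<in> carrier_vec (total_dim n d)" and v: "v \<in> carrier_vec (total_dim n d)"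
    and eq: "\<And>i. i < n \<Longrightarrow> block d u i = block d v i"
  shows "u = v"
proof -
  have uv: "u - v \<in> carrier_vec (total_dim n d)" using u v by simp
  have "(u - v) \<bullet> (u - v) = (\<Sum>i<n. block d (u - v) i \<bullet> block d (u - v) i)"
    by (rule scalar_prod_blocks[OF uv])
  also have "\<dots> = 0"
  proof (intro sum.neutral ballI)
    fix i assume "i \<in> {..<n}"
    then have "block d (u - v) i = block d v i - block d v i"
      using eq[of i] by (simp add: block_minus[OF v])
    then show "block d (u - v) i \<bullet> block d (u - v) i = 0"
      by (simp add: block_def scalar_prod_def)
  qed
  finally have "\<forall>j<total_dim n d. (u - v) $ j = 0"
    by (auto simp: scalar_prod_lessThan[OF uv] sum_nonneg_eq_0_iff)
  then show ?thesis using u v by (intro eq_vecI) auto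
qed

text \<open>The inverse of \<open>block\<close>; it assembles the gradient of a separable sum from
  the gradients of its summands.\<close>

primrec vconcat :: "nat \<Rightarrow> (nat \<Rightarrow> real vec) \<Rightarrow> real vec" where
  "vconcat 0 g = vNil"
| "vconcat (Suc n) g = vconcat n g @\<^sub>v g n"

lemma vconcat_carrier:
  "(\<And>i. i < n \<Longrightarrow> g i \<in> carrier_vec (d i)) \<Longrightarrow> vconcat n g \<in> carrier_vec (total_dim n d)"
  by (induction n) (auto simp: total_dim_def intro!: append_carrier_vec)

lemma block_vconcat:
  assumes "\<And>i. i < n \<Longrightarrow> g i \<in> carrier_vec (d i)" "i < n"
  shows "block d (vconcat n g) i = g i"
  using assms
proof (induction n)
  case (Suc n)
  have c: "vconcat n g \<in> carrier_vec (total_dim n d)"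
    using Suc.prems by (intro vconcat_carrier) auto
  have gn: "g n \<in> carrier_vec (d n)" using Suc.prems by simp
  show ?case
  proof (cases "i = n")
    case True
    show ?thesis
      by (rule eq_vecI) (use True c gn in \<open>auto simp: block_def\<close>)
  next
    case False
    then have i: "i < n" using Suc.prems by simp
    have "block d (vconcat (Suc n) g) i = block d (vconcat n g) i"
    proof (rule eq_vecI)
      fix j assume "j < dim_vec (block d (vconcat n g) i)"
      then have "j < d i" by (simp add: block_def)
      moreover from this have "total_dim i d + j < total_dim n d" by (rule total_dim_add_less[OF i])
      ultimately show "block d (vconcat (Suc n) g) i $ j = block d (vconcat n g) i $ j"
        using c gn by (simp add: block_def)
    qed (simp add: block_def)
    then show ?thesis using Suc.IH Suc.prems i by simp
  qed
qed simp

lemma hcat_index: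
  assumes "\<And>i. i < n \<Longrightarrow> A i \<in> carrier_mat s (d i)" "i < n" "l < s" "j < d i"
  shows "hcat s n A $$ (l, total_dim i d + j) = A i $$ (l, j)"
  using assms
proof (induction n)
  case (Suc n)
  have "hcat s n A \<in> carrier_mat s (total_dim n d)" "A n \<in> carrier_mat s (d n)"
    using Suc.prems hcat_carrier[of n A s d] by auto
  then have dims: "dim_row (hcat s n A) = s" "dim_col (hcat s n A) = total_dim n d"
    "dim_row (A n) = s" "dim_col (A n) = d n" by auto
  show ?case
  proof (cases "i = n")
    case True
    then show ?thesis using Suc.prems(3,4) by (simp add: dims)
  next
    case False
    then have i: "i < n" using Suc.prems by simp
    then have "total_dim i d + j < total_dim n d" using Suc.prems total_dim_add_less by blast
    then show ?thesis using Suc.IH Suc.prems i by (simp add: dims)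
  qed
qed simp

lemma block_transpose_hcat_mult:
  assumes A: "\<And>i. i < n \<Longrightarrow> A i \<in> carrier_mat s (d i)" and i: "i < n" and w: "w \<in> carrier_vec s"
  shows "block d ((hcat s n A)\<^sup>T *\<^sub>v w) i = (A i)\<^sup>T *\<^sub>v w"
proof (rule eq_vecI)
  have H: "hcat s n A \<in> carrier_mat s (total_dim n d)" by (rule hcat_carrier) (rule A)
  show "dim_vec (block d ((hcat s n A)\<^sup>T *\<^sub>v w) i) = dim_vec ((A i)\<^sup>T *\<^sub>v w)"
    using A[OF i] by (simp add: block_def)
  fix j assume "j < dim_vec ((A i)\<^sup>T *\<^sub>v w)"
  then have j: "j < d i" using A[OF i] by simp
  then have t: "total_dim i d + j < total_dim n d" by (rule total_dim_add_less[OF i])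
  have "block d ((hcat s n A)\<^sup>T *\<^sub>v w) i $ j = (\<Sum>l<s. hcat s n A $$ (l, total_dim i d + j) * w $ l)"
    using H j t w by (simp add: block_def scalar_prod_lessThan[of _ s])
  also have "\<dots> = (\<Sum>l<s. A i $$ (l, j) * w $ l)"
    by (intro sum.cong refl) (simp add: hcat_index[of n A s d, OF A i _ j])
  also have "\<dots> = ((A i)\<^sup>T *\<^sub>v w) $ j"
    using A[OF i] j w by (simp add: scalar_prod_lessThan[of _ s])
  finally show "block d ((hcat s n A)\<^sup>T *\<^sub>v w) i $ j = ((A i)\<^sup>T *\<^sub>v w) $ j" .
qed

text \<open>Identifies a block of \<open>Fx\<close> with the direction in the algorithm; the
  right-hand side keeps the order of summands of \<open>extragradient_run\<close>.\<close>

lemma block_vconcat_plus_transpose: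
  assumes A: "\<And>i. i < n \<Longrightarrow> A i \<in> carrier_mat s (d i)" and i: "i < n"
    and g: "\<And>i. i < n \<Longrightarrow> g i \<in> carrier_vec (d i)"
    and y: "y \<in> carrier_vec s" and c: "c \<in> carrier_vec s"
  shows "block d (vconcat n g + (hcat s n A)\<^sup>T *\<^sub>v (y + \<rho> \<cdot>\<^sub>v c)) i
    = (A i)\<^sup>T *\<^sub>v y + g i + \<rho> \<cdot>\<^sub>v ((A i)\<^sup>T *\<^sub>v c)"
proof -
  have H: "(hcat s n A)\<^sup>T \<in> carrier_mat (total_dim n d) s"
    using hcat_carrier[of n A s d] A by simp
  have AT: "(A i)\<^sup>T \<in> carrier_mat (d i) s" using A[OF i] by simp
  have yc: "y + \<rho> \<cdot>\<^sub>v c \<in> carrier_vec s" using y c by simp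
  define a b where "a = (A i)\<^sup>T *\<^sub>v y" and "b = (A i)\<^sup>T *\<^sub>v c"
  have ab: "a \<in> carrier_vec (d i)" "b \<in> carrier_vec (d i)"
    using AT y c by (auto simp: a_def b_def)
  have "block d (vconcat n g + (hcat s n A)\<^sup>T *\<^sub>v (y + \<rho> \<cdot>\<^sub>v c)) i
      = g i + (A i)\<^sup>T *\<^sub>v (y + \<rho> \<cdot>\<^sub>v c)"
    by (simp add: block_add[OF mult_mat_vec_carrier[OF H yc] i] block_vconcat[OF g i]
        block_transpose_hcat_mult[OF A i yc])
  also have "(A i)\<^sup>T *\<^sub>v (y + \<rho> \<cdot>\<^sub>v c) = a + \<rho> \<cdot>\<^sub>v b"
    using AT y c by (simp add: a_def b_def mult_add_distrib_mat_vec[of _ "d i" s] mult_mat_vec[of _ "d i" s])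
  also have "g i + (a + \<rho> \<cdot>\<^sub>v b) = a + g i + \<rho> \<cdot>\<^sub>v b"
    by (rule eq_vecI) (use ab g[OF i] in auto)
  finally show ?thesis by (simp add: a_def b_def)
qed

section \<open>Consequences of the step size rule\<close>

lemma stepsize_bounds:
  fixes \<rho> lam Lr Ll :: real
  defines "\<gamma> \<equiv> stepsize \<rho> lam Lr Ll"
  assumes nonneg: "\<rho> \<ge> 0" "lam \<ge> 0" "Lr \<ge> 0" "Ll \<ge> 0"
  shows "\<gamma> > 0"
    and "\<gamma>\<^sup>2 \<le> 1 / 16" "(\<gamma> * \<rho>)\<^sup>2 \<le> 1 / 16" "\<gamma>\<^sup>2 * lam \<le> 1 / 16" "(\<gamma> * \<rho>)\<^sup>2 * lam \<le> 1 / 16"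
      "(\<gamma> * \<rho> * lam)\<^sup>2 \<le> 1 / 16" "(\<gamma> * Lr)\<^sup>2 \<le> 1 / 16" "(\<gamma> * Ll)\<^sup>2 \<le> 1 / 16"
    and "1 / \<gamma> \<le> 4 * (1 + \<rho> + sqrt ((1 + \<rho>) * lam) + \<rho> * lam + Ll + Lr)"
proof -
  define S where "S = {1, \<rho>, sqrt lam, sqrt (\<rho> * lam), \<rho> * lam, Lr, Ll}"
  have fin: "finite S" "S \<noteq> {}" by (auto simp: S_def)
  have S: "1 \<in> S" "\<rho> \<in> S" "sqrt lam \<in> S" "\<rho> * lam \<in> S" "Lr \<in> S" "Ll \<in> S"
    by (auto simp: S_def)
  have M: "1 \<le> Max S" by (rule Max_ge[OF fin(1) S(1)])
  have \<gamma>: "\<gamma> = 1 / (4 * Max S)"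
    unfolding \<gamma>_def S_def by (rule stepsize_eq[OF nonneg])
  show pos: "\<gamma> > 0" using M by (simp add: \<gamma>)
  have le: "0 \<le> \<gamma> * a \<and> \<gamma> * a \<le> 1 / 4" if "a \<in> S" for a
  proof -
    have "a \<ge> 0" using that nonneg by (auto simp: S_def)
    moreover have "a \<le> Max S" using fin that by simp
    ultimately show ?thesis using M by (simp add: \<gamma> field_simps)
  qed
  \<comment> \<open>Every coefficient to be bounded is a product of two scaled entries of the
    maximum.\<close>
  have prod: "(\<gamma> * a) * (\<gamma> * b) \<le> 1 / 16" if "a \<in> S" "b \<in> S" for a b
    using mult_mono[of "\<gamma> * a" "1 / 4" "\<gamma> * b" "1 / 4"] le[OF that(1)] le[OF that(2)] by simp
  show "\<gamma>\<^sup>2 \<le> 1 / 16" using prod[OF S(1,1)] by (simp add: power2_eq_square)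
  show "(\<gamma> * \<rho>)\<^sup>2 \<le> 1 / 16" using prod[OF S(2,2)] by (simp add: power2_eq_square)
  show "(\<gamma> * \<rho> * lam)\<^sup>2 \<le> 1 / 16" using prod[OF S(4,4)] by (simp add: power2_eq_square mult.assoc)
  show "(\<gamma> * Lr)\<^sup>2 \<le> 1 / 16" using prod[OF S(5,5)] by (simp add: power2_eq_square)
  show "(\<gamma> * Ll)\<^sup>2 \<le> 1 / 16" using prod[OF S(6,6)] by (simp add: power2_eq_square)
  have "\<gamma>\<^sup>2 * lam = (\<gamma> * sqrt lam) * (\<gamma> * sqrt lam)"
    using nonneg by (simp add: power2_eq_square)
  then show "\<gamma>\<^sup>2 * lam \<le> 1 / 16" using prod[OF S(3,3)] by simp
  \<comment> \<open>Here the two entries differ: \<open>\<rho>\<close> and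
    \<open>\<rho> * lam\<close>.\<close>
  have "(\<gamma> * \<rho>)\<^sup>2 * lam = (\<gamma> * \<rho>) * (\<gamma> * (\<rho> * lam))"
    by (simp add: power2_eq_square)
  then show "(\<gamma> * \<rho>)\<^sup>2 * lam \<le> 1 / 16" by (rule ord_eq_le_trans[OF _ prod[OF S(2,4)]])
  have sqrts: "sqrt lam \<le> sqrt ((1 + \<rho>) * lam)" "sqrt (\<rho> * lam) \<le> sqrt ((1 + \<rho>) * lam)"
    using nonneg by (auto simp: distrib_right)
  have rl: "0 \<le> \<rho> * lam" "0 \<le> sqrt ((1 + \<rho>) * lam)" using nonneg by auto
  \<comment> \<open>Each entry is dominated by a single summand, both square roots by the same one;
    the other summands are nonnegative.\<close>
  have "a \<le> 1 + \<rho> + sqrt ((1 + \<rho>) * lam) + \<rho> * lam + Ll + Lr" if "a \<in> S" for a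
    using that sqrts rl nonneg unfolding S_def by (elim insertE emptyE) linarith+
  then have "Max S \<le> 1 + \<rho> + sqrt ((1 + \<rho>) * lam) + \<rho> * lam + Ll + Lr"
    using fin by simp
  then show "1 / \<gamma> \<le> 4 * (1 + \<rho> + sqrt ((1 + \<rho>) * lam) + \<rho> * lam + Ll + Lr)"
    by (simp add: \<gamma>)
qed

section \<open>From the abstract bound to the gap\<close>

text \<open>The two terms depend on separate variables, so a bound uniform in all of them passes
  first to the supremum over \<open>y'\<close> and then to the infimum over \<open>(x', z')\<close>;
  nonemptiness suffices for both.\<close>

lemma gap_aug_le:
  assumes "X \<noteq> {}" "Z \<noteq> {}" "Y \<noteq> {}"
    and le: "\<And>x' z' y'. x' \<in> X \<Longrightarrow> z' \<in> Z \<Longrightarrow> y' \<in> Y \<Longrightarrow>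
      L_aug n s d A ell b r \<rho> x z y' - L_aug n s d A ell b r \<rho> x' z' y \<le> B"
  shows "gap_aug n s d A ell b r \<rho> X Z Y x z y \<le> B"
proof -
  let ?L = "L_aug n s d A ell b r \<rho>"
  have "(SUP y'\<in>Y. ?L x z y') \<le> B + ?L x' z' y" if "x' \<in> X" "z' \<in> Z" for x' z'
    using assms(3) by (intro cSUP_least) (auto dest: le[OF that])
  then have "(SUP y'\<in>Y. ?L x z y') - B \<le> ?L x' z' y" if "x' \<in> X" "z' \<in> Z" for x' z'
    using that by (simp add: algebra_simps)
  then have "(SUP y'\<in>Y. ?L x z y') - B \<le> (INF (x', z')\<in>X \<times> Z. ?L x' z' y)"
    using assms(1,2) by (intro cINF_greatest) auto
  then show ?thesis by (simp add: gap_aug_def)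
qed

text \<open>The sum of the \<open>r i\<close> is separable, so scalar products with its gradient and
  squared gradient differences split over the blocks. Because all blocks share \<open>Lr\<close>,
  this constant also serves for the sum.\<close>

lemma augmented_lagrangian_blocks:
  fixes d :: "nat \<Rightarrow> nat" and r :: "nat \<Rightarrow> real vec \<Rightarrow> real"
  assumes n: "n \<ge> 1" and d: "\<And>i. i < n \<Longrightarrow> d i \<ge> 1"
    and A: "\<And>i. i < n \<Longrightarrow> A i \<in> carrier_mat s (d i)"
    and \<rho>: "\<rho> \<ge> 0"
    and h: "vsmooth s Ll h" "vconvex s h"
    and r: "\<And>i. i < n \<Longrightarrow> vsmooth (d i) Lr (r i) \<and> vconvex (d i) (r i)"
  shows "augmented_lagrangian (total_dim n d) s (hcat s n A)
    (\<lambda>u. \<Sum>i<n. r i (block d u i)) h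
    (\<lambda>u. vconcat n (\<lambda>i. vgrad (d i) (r i) (block d u i))) (vgrad s h)
    \<rho> (lambda_max ((hcat s n A)\<^sup>T * hcat s n A)) Lr Ll"
proof -
  define m where "m = total_dim n d"
  define H where "H = hcat s n A"
  define lam where "lam = lambda_max (H\<^sup>T * H)"
  define gr where "gr u = (\<lambda>i. vgrad (d i) (r i) (block d u i))" for u
  have H: "H \<in> carrier_mat s m" unfolding H_def m_def by (rule hcat_carrier) (rule A)
  have gr: "gr u i \<in> carrier_vec (d i)" if "i < n" for u i
    unfolding gr_def using r[OF that] by (intro vsmooth_vgrad_carrier block_carrier) auto
  have g: "vconcat n (gr u) \<in> carrier_vec m" for u
    unfolding m_def by (rule vconcat_carrier) (rule gr)
  \<comment> \<open>A unit vector exists, and testing the operator bound on it shows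
    \<open>lam \<ge> 0\<close>.\<close>
  have "0 < m" using total_dim_add_less[of 0 n 0 d] n d[of 0] by (simp add: m_def total_dim_def)
  then have lam: "0 \<le> lam"
    using mult_mat_vec_le_lambda_max[OF H, of "unit_vec m 0"]
      scalar_prod_self_nonneg[of "H *\<^sub>v unit_vec m 0"] by (simp add: lam_def)
  have "augmented_lagrangian m s H (\<lambda>u. \<Sum>i<n. r i (block d u i)) h
    (\<lambda>u. vconcat n (gr u)) (vgrad s h) \<rho> lam Lr Ll"
  proof
    fix u v :: "real vec" assume u: "u \<in> carrier_vec m" and v: "v \<in> carrier_vec m"
    have "vconcat n (gr u) \<bullet> (v - u) = (\<Sum>i<n. gr u i \<bullet> (block d v i - block d u i))"
      using u v gr by (simp add: scalar_prod_blocks[of _ n d] m_def block_vconcat block_minus[of _ n])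
    then have "(\<Sum>i<n. r i (block d u i)) + vconcat n (gr u) \<bullet> (v - u)
        = (\<Sum>i<n. r i (block d u i) + gr u i \<bullet> (block d v i - block d u i))"
      by (simp add: sum.distrib)
    also have "\<dots> \<le> (\<Sum>i<n. r i (block d v i))"
    proof (rule sum_mono)
      fix i assume "i \<in> {..<n}"
      then have ri: "vsmooth (d i) Lr (r i)" "vconvex (d i) (r i)" using r by auto
      show "r i (block d u i) + gr u i \<bullet> (block d v i - block d u i) \<le> r i (block d v i)"
        unfolding gr_def
        by (rule vconvex_gradient_ineq[OF ri(2) vsmooth_has_vgrad[OF ri(1)]])
          (rule block_carrier)+
    qed
    finally show "(\<Sum>i<n. r i (block d u i)) + vconcat n (gr u) \<bullet> (v - u) \<le> (\<Sum>i<n. r i (block d v i))" .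
    have "(vconcat n (gr u) - vconcat n (gr v)) \<bullet> (vconcat n (gr u) - vconcat n (gr v))
        = (\<Sum>i<n. (gr u i - gr v i) \<bullet> (gr u i - gr v i))"
      using g[unfolded m_def] gr by (simp add: scalar_prod_blocks[of _ n d] block_vconcat block_minus[of _ n])
    also have "\<dots> \<le> (\<Sum>i<n. Lr\<^sup>2 * ((block d u i - block d v i) \<bullet> (block d u i - block d v i)))"
      unfolding gr_def using r by (intro sum_mono vsmooth_lipschitz_sq block_carrier) auto
    also have "\<dots> = Lr\<^sup>2 * ((u - v) \<bullet> (u - v))"
      using u v by (simp add: scalar_prod_blocks[of _ n d] m_def block_minus[of _ n] sum_distrib_left)
    finally show "(vconcat n (gr u) - vconcat n (gr v)) \<bullet> (vconcat n (gr u) - vconcat n (gr v))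
        \<le> Lr\<^sup>2 * ((u - v) \<bullet> (u - v))" .
  qed (use H g lam \<rho> h in \<open>auto simp: lam_def intro: vsmooth_vgrad_carrier vsmooth_has_vgrad
      vconvex_gradient_ineq vsmooth_lipschitz_sq mult_mat_vec_le_lambda_max\<close>)
  then show ?thesis by (simp add: m_def H_def lam_def gr_def)
qed

lemma extragradient_gap_aug_le:
  fixes d :: "nat \<Rightarrow> nat" and r :: "nat \<Rightarrow> real vec \<Rightarrow> real"
    and ell :: "real vec \<Rightarrow> real vec \<Rightarrow> real" and L\<^sub>l L\<^sub>r :: real
  assumes n: "n \<ge> 1" and d: "\<And>i. i < n \<Longrightarrow> d i \<ge> 1"
    and blocks: "\<And>i. i < n \<Longrightarrow> A i \<in> carrier_mat s (d i)"
    and X: "X \<noteq> {}" "vcompact (total_dim n d) X" and Z: "Z \<noteq> {}" "vcompact s Z"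
    and Y: "Y \<noteq> {}" "vcompact s Y"
    and \<rho>: "\<rho> \<ge> 0"
    and h: "vsmooth s L\<^sub>l (\<lambda>u. ell u b)" "vconvex s (\<lambda>u. ell u b)"
    and r: "\<And>i. i < n \<Longrightarrow> vsmooth (d i) L\<^sub>r (r i) \<and> vconvex (d i) (r i)"
    and lam_eq: "lam = lambda_max ((hcat s n A)\<^sup>T * hcat s n A)"
    and K: "K \<ge> 1"
    and run: "extragradient_run n s d A ell b r \<rho> (stepsize \<rho> lam L\<^sub>r L\<^sub>l) K x z y xh zh yh"
  shows "gap_aug n s d A ell b r \<rho> X Z Y
      (vaverage (total_dim n d) K xh) (vaverage s K zh) (vaverage s K yh)
    \<le> 2 * ((1 + \<rho> + sqrt ((1 + \<rho>) * lam) + \<rho> * lam + L\<^sub>l + L\<^sub>r)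
          * max_sq_dist X Z Y (x 0) (z 0) (y 0) / real K)"
proof -
  define m where "m = total_dim n d"
  define H where "H = hcat s n A"
  define gr where "gr u = (\<lambda>i. vgrad (d i) (r i) (block d u i))" for u
  define \<gamma> where "\<gamma> = stepsize \<rho> lam L\<^sub>r L\<^sub>l"
  interpret augmented_lagrangian m s H "\<lambda>u. \<Sum>i<n. r i (block d u i)" "\<lambda>u. ell u b"
    "\<lambda>u. vconcat n (gr u)" "vgrad s (\<lambda>u. ell u b)" \<rho> lam L\<^sub>r L\<^sub>l
    unfolding m_def H_def gr_def lam_eq
    by (rule augmented_lagrangian_blocks) (use n d blocks \<rho> h r in auto)
  have gr: "gr u i \<in> carrier_vec (d i)" if "i < n" for u i
    unfolding gr_def using r[OF that] by (intro vsmooth_vgrad_carrier block_carrier) auto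
  have "L\<^sub>r \<ge> 0" "L\<^sub>l \<ge> 0" using r[of 0] n h by (auto simp: vsmooth_def)
  note \<gamma> = stepsize_bounds[OF \<rho> lam this, folded \<gamma>_def]
  note run = run[folded \<gamma>_def, unfolded extragradient_run_def, folded m_def H_def]
  have st: "state (x k) (z k) (y k)" if "k \<le> K" for k
    using run that unfolding state_def by blast
  have sth: "state (xh k) (zh k) (yh k)" if "k < K" for k
    using run that unfolding state_def by blast
  \<comment> \<open>Equality of the full vectors follows from the blockwise updates since blocks
    determine a vector.\<close>
  have x_step: "v = u - \<gamma> \<cdot>\<^sub>v Fx x' z' y'"
    if "v \<in> carrier_vec m" "u \<in> carrier_vec m" "state x' z' y'"
      and eq: "\<And>i. i < n \<Longrightarrow> block d v i = block d u i - \<gamma> \<cdot>\<^sub>v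
        ((A i)\<^sup>T *\<^sub>v y' + vgrad (d i) (r i) (block d x' i) + \<rho> \<cdot>\<^sub>v ((A i)\<^sup>T *\<^sub>v (H *\<^sub>v x' - z')))"
    for u v x' z' y'
  proof (rule block_eqI[of _ n d])
    note c = state_carriers[OF that(3)]
    show "v \<in> carrier_vec (total_dim n d)" "u - \<gamma> \<cdot>\<^sub>v Fx x' z' y' \<in> carrier_vec (total_dim n d)"
      using that(1,2) c(7) by (auto simp: m_def)
    fix i assume i: "i < n"
    have "block d (Fx x' z' y') i = (A i)\<^sup>T *\<^sub>v y' + gr x' i + \<rho> \<cdot>\<^sub>v ((A i)\<^sup>T *\<^sub>v (H *\<^sub>v x' - z'))"
      unfolding Fx_def price_def unfolding H_def
      by (rule block_vconcat_plus_transpose[OF blocks i gr c(3) c(5)[unfolded H_def]])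
    then show "block d v i = block d (u - \<gamma> \<cdot>\<^sub>v Fx x' z' y') i"
      using c(7) i by (simp add: eq m_def block_minus[of _ n] block_smult[of _ n] gr_def)
  qed
  \<comment> \<open>The algorithm writes the penalty term with \<open>z' - H x'\<close>, whereas
    \<open>price\<close> contains the opposite residual with the opposite sign.\<close>
  have Fz_eq: "vgrad s (\<lambda>u. ell u b) z' - y' + \<rho> \<cdot>\<^sub>v (z' - H *\<^sub>v x') = Fz x' z' y'"
    if "state x' z' y'" for x' z' y'
    unfolding Fz_def price_def
    by (rule eq_vecI) (use state_carriers(1-5)[OF that] gh A in \<open>auto simp: algebra_simps\<close>)
  have L_aug_eq: "L_aug n s d A ell b r \<rho> x' z' y' = Lagr x' z' y'" if "x' \<in> carrier_vec m" for x' z' y'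
  proof -
    have "finsum_vec TYPE(real) s (\<lambda>i. A i *\<^sub>v block d x' i) {..<n} = H *\<^sub>v x'"
      using hcat_mult_vec[of n A s d x'] blocks that by (simp add: H_def m_def)
    then show ?thesis by (simp add: L_aug_def Lagr_def vnorm_power2 Let_def)
  qed
  have hc: "xh k \<in> carrier_vec m" "zh k \<in> carrier_vec s" "yh k \<in> carrier_vec s" if "k < K" for k
    using sth[OF that] by (auto simp: state_def)
  define T where "T = 1 + \<rho> + sqrt ((1 + \<rho>) * lam) + \<rho> * lam + L\<^sub>l + L\<^sub>r"
  define D where "D = max_sq_dist X Z Y (x 0) (z 0) (y 0)"
  show ?thesis
  proof (rule gap_aug_le[OF X(1) Z(1) Y(1)], fold m_def T_def D_def)
    fix x' z' y' assume w: "x' \<in> X" "z' \<in> Z" "y' \<in> Y"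
    \<comment> \<open>Only the carrier part of the boundedness result matters, so the zero vector is
      taken as centre.\<close>
    have sub: "S \<subseteq> carrier_vec k" if "vcompact k S" for k S
      using vcompact_sq_dist_bounded[OF that zero_carrier_vec] by blast
    have sw: "state x' z' y'"
      using sub[OF X(2), folded m_def] sub[OF Z(2)] sub[OF Y(2)] w by (auto simp: state_def)
    let ?D = "(x 0 - x') \<bullet> (x 0 - x') + (z 0 - z') \<bullet> (z 0 - z') + (y 0 - y') \<bullet> (y 0 - y')"
    have D: "?D \<le> D"
      using sq_dist_le_max_sq_dist[OF X(2)[folded m_def] Z(2) Y(2) _ _ _ w, of "x 0" "z 0" "y 0"]
        state_carriers(1-3)[OF st[of 0]] by (simp add: D_def vnorm_power2)
    have D0: "0 \<le> ?D" by (simp add: scalar_prod_self_nonneg add_nonneg_nonneg)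
    have "Lagr (vaverage m K xh) (vaverage s K zh) y' - Lagr x' z' (vaverage s K yh)
        \<le> ?D / (2 * \<gamma> * real K)"
    proof (rule extragradient_gap[OF \<gamma>(1-8)])
      fix k assume k: "k < K"
      note s = st[OF less_imp_le[OF k]] and sh = sth[OF k] and s' = st[OF Suc_leI[OF k]]
      note c = state_carriers[OF s] and ch = state_carriers[OF sh] and c' = state_carriers[OF s']
      show "xh k = x k - \<gamma> \<cdot>\<^sub>v Fx (x k) (z k) (y k)"
        by (rule x_step[OF ch(1) c(1) s]) (use run k in blast)
      show "x (Suc k) = x k - \<gamma> \<cdot>\<^sub>v Fx (xh k) (zh k) (yh k)"
        by (rule x_step[OF c'(1) c(1) sh]) (use run k in blast)
      show "zh k = z k - \<gamma> \<cdot>\<^sub>v Fz (x k) (z k) (y k)"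
        unfolding Fz_eq[OF s, symmetric] using run k by blast
      show "z (Suc k) = z k - \<gamma> \<cdot>\<^sub>v Fz (xh k) (zh k) (yh k)"
        unfolding Fz_eq[OF sh, symmetric] using run k by blast
      show "yh k = y k + \<gamma> \<cdot>\<^sub>v (H *\<^sub>v x k - z k)" using run k by blast
      show "y (Suc k) = y k + \<gamma> \<cdot>\<^sub>v (H *\<^sub>v xh k - zh k)" using run k by blast
    qed (use K st sth sw in auto)
    also have "\<dots> = 1 / \<gamma> * ?D / (2 * real K)" by simp
    \<comment> \<open>The factor 4 from \<open>1 / \<gamma>\<close> and the 2 in the denominator
      leave the constant 2. Replacing both factors of the product uses \<open>?D \<ge> 0\<close> and
      \<open>T \<ge> 0\<close>.\<close>
    also have "\<dots> \<le> 4 * T * D / (2 * real K)"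
    proof (intro divide_right_mono mult_mono D D0)
      show T: "1 / \<gamma> \<le> 4 * T" unfolding T_def by (rule \<gamma>(9))
      have "0 < 1 / \<gamma>" using \<gamma>(1) by simp
      with T show "0 \<le> 4 * T" by linarith
    qed simp
    finally show "L_aug n s d A ell b r \<rho> (vaverage m K xh) (vaverage s K zh) y'
        - L_aug n s d A ell b r \<rho> x' z' (vaverage s K yh) \<le> 2 * (T * D / real K)"
      using L_aug_eq[OF vaverage_carrier[of K xh, OF hc(1)]] L_aug_eq[OF state_carriers(1)[OF sw]]
      by (simp add: mult_ac)
  qed
qed

theorem theorem9:
  shows "\<exists>C::real. C > 0 \<and>
    (\<forall>(n::nat) (s::nat) (d :: nat \<Rightarrow> nat) (A :: nat \<Rightarrow> real mat)
        (ell :: real vec \<Rightarrow> real vec \<Rightarrow> real) (b :: real vec) (r :: nat \<Rightarrow> real vec \<Rightarrow> real)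
        (\<rho>::real) (L\<^sub>l::real) (L\<^sub>r::real)
        (X :: real vec set) (Z :: real vec set) (Y :: real vec set) (K::nat)
        (x :: nat \<Rightarrow> real vec) (z :: nat \<Rightarrow> real vec) (y :: nat \<Rightarrow> real vec)
        (xh :: nat \<Rightarrow> real vec) (zh :: nat \<Rightarrow> real vec) (yh :: nat \<Rightarrow> real vec) (lam::real).
      n \<ge> 1 \<longrightarrow> s \<ge> 1 \<longrightarrow> (\<forall>i<n. d i \<ge> 1) \<longrightarrow>
      (\<forall>i<n. A i \<in> carrier_mat s (d i)) \<longrightarrow> b \<in> carrier_vec s \<longrightarrow>
      X \<noteq> {} \<longrightarrow> vcompact (total_dim n d) X \<longrightarrow>
      Z \<noteq> {} \<longrightarrow> vcompact s Z \<longrightarrow>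
      Y \<noteq> {} \<longrightarrow> vcompact s Y \<longrightarrow>
      \<rho> \<ge> 0 \<longrightarrow>
      vsmooth s L\<^sub>l (\<lambda>u. ell u b) \<longrightarrow> vconvex s (\<lambda>u. ell u b) \<longrightarrow>
      (\<forall>i<n. vsmooth (d i) L\<^sub>r (r i) \<and> vconvex (d i) (r i)) \<longrightarrow>
      lam = lambda_max ((hcat s n A)\<^sup>T * hcat s n A) \<longrightarrow>
      K \<ge> 1 \<longrightarrow>
      extragradient_run n s d A ell b r \<rho> (stepsize \<rho> lam L\<^sub>r L\<^sub>l) K x z y xh zh yh \<longrightarrow>
      gap_aug n s d A ell b r \<rho> X Z Y
          (vaverage (total_dim n d) K xh) (vaverage s K zh) (vaverage s K yh)
        \<le> C * ((1 + \<rho> + sqrt ((1 + \<rho>) * lam) + \<rho> * lam + L\<^sub>l + L\<^sub>r)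
                * max_sq_dist X Z Y (x 0) (z 0) (y 0) / real K))"
  by (intro exI[of _ 2] conjI allI impI extragradient_gap_aug_le) auto

end
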